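(* (a) Every nonnegative integer $n$ can be written as $n=p_3(x)+p_5(y)+p_{11}(z)$ with $x,y,z\in\mathbb{Z}$. (b) Every nonnegative integer $n$ can be written as $n=3p_3(x)+p_5(y)+p_7(z)$ with $x,y,z\in\mathbb{Z}$.
   Context: For an integer $m\geq 3$ and $x\in\mathbb{Z}$, $p_m(x)=(m-2)\frac{x(x-1)}{2}+x$. Thus $p_3(x)=\frac{x(x+1)}{2}$, $p_5(x)=\frac{3x^2-x}{2}$, $p_7(x)=\frac{5x^2-3x}{2}$, $p_{11}(x)=\frac{9x^2-7x}{2}$. *)

theory Defs
  imports Complex_Main
begin

text \<open>
  Generalized \<open>m\<close>-gonal numbers, intended for \<open>m \<ge> 3\<close>; the argument ranges over all integers.
  The integer division is exact, since \<open>x * (x - 1)\<close> is even.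
\<close>

definition polygonal :: "nat \<Rightarrow> int \<Rightarrow> int"
  where "polygonal m x = (int m - 2) * (x * (x - 1) div 2) + x"

lemma of_int_polygonal:
  "real_of_int (polygonal m x) = (real m - 2) * (of_int x * (of_int x - 1) / 2) + of_int x"
proof -
  have "even (x * (x - 1))"
    by auto
  then have "real_of_int (x * (x - 1) div 2) = of_int x * (of_int x - 1) / 2"
    by (simp add: real_of_int_div)
  then show ?thesis
    by (simp add: polygonal_def)
qed

lemma polygonal_examples:
  "real_of_int (polygonal 3 x) = of_int x * (of_int x + 1) / 2"
  "real_of_int (polygonal 5 x) = (3 * of_int x ^ 2 - of_int x) / 2"
  "real_of_int (polygonal 7 x) = (5 * of_int x ^ 2 - 3 * of_int x) / 2"
  "real_of_int (polygonal 11 x) = (9 * of_int x ^ 2 - 7 * of_int x) / 2"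
  by (simp_all add: of_int_polygonal field_simps power2_eq_square)

end

(*
Completing squares, n has the form (a) iff 72 n + 61 = 9 X^2 + 3 Y^2 + Z^2, and the form (b) iff
120 n + 77 = 45 X^2 + 5 Y^2 + 3 Z^2, with congruence conditions on X, Y, Z. Both numbers are N = 5 (mod 8)
and prime to 3, and such an N is a sum x^2 + y^2 + 3 z^2. From one such representation the congruences
are reached by halving, by the rotation (x, z) -> ((x + 3 z) / 2, (x - z) / 2) of x^2 + 3 z^2, and for (b) by
the identity 5 (Y^2 + W^2) = (Y + 2 W)^2 + (2 Y - W)^2.

To represent N, let m be its squarefree part. If q is a prime with q = 1 (mod 3) and (-q/p) = 1 for all
primes p dividing m, then the pigeonhole principle solves m w^2 = x^2 + q s^2 and q u^2 = y^2 + 3 z^2, so N is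
represented over the rationals by x^2 + y^2 + 3 z^2, equivalently by x^2 + x y + y^2 + z^2. For the latter form
the Davenport-Cassels descent leads from rational to integral representations. The prime q has
prescribed Legendre symbols only, so its existence needs Dirichlet's argument just for real characters,
where L(1) is nonzero by Monsky's elementary proof.
*)

theory Submission
  imports Defs "HOL-Library.Discrete_Functions" "HOL-Number_Theory.Number_Theory"
    "HOL-Computational_Algebra.Squarefree"
begin

section \<open>Real characters and the von Mangoldt function\<close>

text \<open>The auxiliary prime q splits one ternary problem into two instances of Legendre's
  equation: q is taken as a rational value of y^2 + 3 z^2 and then m as a rational value of x^2 + q
  s^2, and substituting the first into the second represents m. One of the solvability conditions is
  that m is a square modulo q. Because m = 1 (mod 4), reciprocity derives it from the symbols (q/p)
  for p dividing m, so no congruence for q modulo 4 or 8 has to be prescribed. Quadratic symbols at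
  odd primes suffice, and this keeps complex characters out. The change of form is forced by the
  descent: for x^2 + y^2 + 3 z^2, rounding to the nearest lattice point can leave 1/4 + 1/4 + 3/4 >
  1, whereas for x^2 + x y + y^2 + z^2 the remainder can be kept within 11/16.\<close>

lemma sum_hyperbola:
  fixes g :: "nat \<Rightarrow> nat \<Rightarrow> real"
  shows "(\<Sum>n=1..X. \<Sum>k=1..X div n. g n k) = (\<Sum>j=1..X. \<Sum>d | d dvd j. g d (j div d))"
proof -
  have "(\<Sum>n=1..X. \<Sum>k=1..X div n. g n k) = (\<Sum>(n,k)\<in>(SIGMA n:{1..X}. {1..X div n}). g n k)"
    by (rule sum.Sigma) auto
  also have "\<dots> = (\<Sum>(j,d)\<in>(SIGMA j:{1..X}. {d. d dvd j}). g d (j div d))"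
  proof (rule sum.reindex_bij_witness[where i = "\<lambda>(j,d). (d, j div d)" and j = "\<lambda>(n,k). (n * k, n)"])
    fix a assume "a \<in> (SIGMA n:{1..X}. {1..X div n})"
    then obtain n k where a: "a = (n, k)" "1 \<le> n" "n \<le> X" "1 \<le> k" "k \<le> X div n" by auto
    have "k * n \<le> X" using a by (simp add: less_eq_div_iff_mult_less_eq)
    then show "(case case a of (n, k) \<Rightarrow> (n * k, n) of (j, d) \<Rightarrow> (d, j div d)) = a"
      "(case a of (n, k) \<Rightarrow> (n * k, n)) \<in> (SIGMA j:{1..X}. {d. d dvd j})"
      "(case case a of (n, k) \<Rightarrow> (n * k, n) of (j, d) \<Rightarrow> g d (j div d)) = (case a of (n, k) \<Rightarrow> g n k)"
      using a by (simp_all add: mult.commute)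
  next
    fix b assume "b \<in> (SIGMA j:{1..X}. {d. d dvd j})"
    then obtain j d where b: "b = (j, d)" "1 \<le> j" "j \<le> X" "d dvd j" by auto
    then obtain k where k: "j = d * k" by auto
    have "d \<ge> 1" "k \<ge> 1" using b k by (simp_all add: Suc_le_eq)
    moreover have "k \<le> X div d" using b(3) k \<open>d \<ge> 1\<close> by (simp add: less_eq_div_iff_mult_less_eq mult.commute)
    moreover have "d \<le> X" using \<open>k \<ge> 1\<close> b(3) unfolding k by (metis le_trans mult_le_mono2 nat_mult_1_right)
    ultimately show "(case case b of (j, d) \<Rightarrow> (d, j div d) of (n, k) \<Rightarrow> (n * k, n)) = b"
      "(case b of (j, d) \<Rightarrow> (d, j div d)) \<in> (SIGMA n:{1..X}. {1..X div n})"
      using b k by simp_all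
  qed
  also have "\<dots> = (\<Sum>j=1..X. \<Sum>d | d dvd j. g d (j div d))"
    by (rule sum.Sigma[symmetric]) auto
  finally show ?thesis .
qed

section \<open>Chebyshev and Mertens estimates for the von Mangoldt function\<close>

lemma ln_fact_mangoldt: "ln (fact X) = (\<Sum>d=1..X. mangoldt d * real (X div d))"
proof -
  have "(\<Sum>d=1..X. mangoldt d * real (X div d)) = (\<Sum>d=1..X. \<Sum>k=1..X div d. mangoldt d :: real)"
    by (simp add: mult.commute)
  also have "\<dots> = (\<Sum>j=1..X. \<Sum>d | d dvd j. mangoldt d)" by (rule sum_hyperbola)
  also have "\<dots> = (\<Sum>j=1..X. ln (real j))"
    by (intro sum.cong refl) (simp add: mangoldt_sum)
  also have "\<dots> = ln (fact X)"
    by (induction X) (simp_all add: ln_mult)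
  finally show ?thesis by simp
qed

text \<open>The lower half of Mertens' theorem: ln X! is at least X ln X - X, and replacing
  \<open>X div d\<close> by X / d in its expansion only increases it. The divergence is the main
  term in the search for q.\<close>

lemma sum_mangoldt_div_ge:
  assumes "X > 0"
  shows "(\<Sum>d=1..X. mangoldt d / real d) \<ge> ln (real X) - 1"
proof -
  have "real n * ln (real n) - real n \<le> ln (fact n)" for n
  proof (induction n)
    case (Suc n)
    have "real (Suc n) * ln (real (Suc n)) - real (Suc n) \<le> real n * ln (real n) - real n + ln (real (Suc n))"
    proof (cases "n = 0")
      case False
      have "ln (real (Suc n) / real n) \<le> real (Suc n) / real n - 1"
        using False by (intro ln_le_minus_one) simp
      then have "ln (real (Suc n)) - ln (real n) \<le> 1 / real n"
        using False by (simp add: ln_div field_simps)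
      then have "real n * (ln (real (Suc n)) - ln (real n)) \<le> 1"
        using False by (simp add: field_simps)
      then show ?thesis by (simp add: algebra_simps)
    qed simp
    then show ?case using Suc by (simp add: ln_mult)
  qed simp
  also have "ln (fact X) = (\<Sum>d=1..X. mangoldt d * real (X div d))" by (rule ln_fact_mangoldt)
  also have "\<dots> \<le> (\<Sum>d=1..X. mangoldt d * (real X / real d))"
    by (intro sum_mono mult_left_mono mangoldt_nonneg) (rule of_nat_div_le_of_nat)
  also have "\<dots> = real X * (\<Sum>d=1..X. mangoldt d / real d)"
    by (simp add: sum_distrib_left mult_ac)
  finally have "real X * (ln (real X) - 1) \<le> real X * (\<Sum>d=1..X. mangoldt d / real d)"
    by (simp add: algebra_simps)
  then show ?thesis using assms by simp
qed

text \<open>Chebyshev's argument: the coefficient \<open>2 * n div d\<close> minus twice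
  \<open>n div d\<close> is never negative and is at least 1 for n < d <= 2 n, while the sum over
  all d is the logarithm of the central binomial coefficient.\<close>

lemma sum_mangoldt_dyadic: "(\<Sum>d=n+1..2*n. mangoldt d) \<le> real n * ln 4"
proof -
  have "(\<Sum>d=n+1..2*n. mangoldt d) \<le> (\<Sum>d=n+1..2*n. mangoldt d * (real (2 * n div d) - 2 * real (n div d)))"
  proof (rule sum_mono)
    fix d assume "d \<in> {n+1..2*n}"
    then have "n div d = 0" "2 * n div d \<ge> 1" by (simp_all add: less_eq_div_iff_mult_less_eq)
    then have "1 \<le> real (2 * n div d) - 2 * real (n div d)" by simp
    then show "mangoldt d \<le> mangoldt d * (real (2 * n div d) - 2 * real (n div d))"
      using mangoldt_nonneg[of d] by (simp add: mult_le_cancel_left1)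
  qed
  also have "\<dots> \<le> (\<Sum>d=1..2*n. mangoldt d * (real (2 * n div d) - 2 * real (n div d)))"
  proof (rule sum_mono2)
    fix d
    have "2 * (n div d) \<le> 2 * n div d"
    proof (cases "d = 0")
      case False
      moreover have "2 * (n div d) * d \<le> 2 * n" by (simp add: mult.assoc)
      ultimately show ?thesis by (simp add: less_eq_div_iff_mult_less_eq)
    qed simp
    then have "2 * real (n div d) \<le> real (2 * n div d)" by (metis of_nat_le_iff of_nat_mult of_nat_numeral)
    then show "0 \<le> mangoldt d * (real (2 * n div d) - 2 * real (n div d))"
      by (intro mult_nonneg_nonneg mangoldt_nonneg) simp
  qed auto
  also have "\<dots> = (\<Sum>d=1..2*n. mangoldt d * real (2 * n div d)) - 2 * (\<Sum>d=1..2*n. mangoldt d * real (n div d))"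
    by (simp add: sum_subtractf sum_distrib_left algebra_simps)
  also have "(\<Sum>d=1..2*n. mangoldt d * real (n div d)) = (\<Sum>d=1..n. mangoldt d * real (n div d))"
    by (rule sum.mono_neutral_right) auto
  also have "(\<Sum>d=1..2*n. mangoldt d * real (2 * n div d)) - 2 * (\<Sum>d=1..n. mangoldt d * real (n div d))
      = ln (fact (2 * n)) - 2 * ln (fact n)"
    by (simp add: ln_fact_mangoldt)
  also have "\<dots> = ln (real (2 * n choose n))"
    by (simp add: binomial_fact ln_div ln_mult)
  also have "\<dots> \<le> ln (4 ^ n)"
  proof -
    have "2 * n choose n \<le> 2 ^ (2 * n)" by (rule binomial_le_pow2)
    then have "2 * n choose n \<le> 4 ^ n" by (simp add: power_mult)
    then have "real (2 * n choose n) \<le> 4 ^ n" by (metis of_nat_le_iff of_nat_numeral of_nat_power)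
    then show ?thesis by (intro ln_mono) simp_all
  qed
  also have "\<dots> = real n * ln 4" by (simp add: ln_realpow)
  finally show ?thesis .
qed

lemma sum_mangoldt_le: "(\<Sum>d=1..X. mangoldt d) \<le> 2 * ln 4 * real X"
proof (cases "X = 0")
  case False
  have pow2: "(\<Sum>d=1..2^k. mangoldt d) \<le> 2 ^ k * ln (4::real)" for k :: nat
  proof (induction k)
    case (Suc k)
    have "{1..2 * (2::nat) ^ k} = {1..2 ^ k} \<union> {2 ^ k + 1..2 * 2 ^ k}" by auto
    then have "(\<Sum>d=1..2^Suc k. mangoldt d) = (\<Sum>d=1..2^k. mangoldt d) + (\<Sum>d=2^k+1..2*2^k. mangoldt d :: real)"
      by (simp add: sum.union_disjoint)
    also have "\<dots> \<le> 2 ^ k * ln 4 + 2 ^ k * ln 4"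
      using Suc sum_mangoldt_dyadic[of "2 ^ k"] by (intro add_mono) simp_all
    finally show ?case by simp
  qed simp
  obtain k where k: "2 ^ k \<le> X" "X < 2 ^ Suc k" using False ex_power_ivl1[of 2 X] by auto
  have "(\<Sum>d=1..X. mangoldt d) \<le> (\<Sum>d=1..2^Suc k. mangoldt d :: real)"
    using k by (intro sum_mono2 mangoldt_nonneg) auto
  also have "\<dots> \<le> 2 ^ Suc k * ln 4" by (rule pow2)
  also have "\<dots> = 2 * ln 4 * real (2 ^ k)" by simp
  also have "\<dots> \<le> 2 * ln 4 * real X"
    using k by (intro mult_left_mono) (simp_all del: of_nat_power)
  finally show ?thesis .
qed simp

text \<open>Summation by parts. The bound on partial sums concerns sums from 1, so a start at
  \<open>a\<close> also pays for the part below \<open>a\<close>; hence the factor 2.\<close>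

lemma abel_summation_bound:
  fixes f g :: "nat \<Rightarrow> real"
  assumes B: "\<And>N. \<bar>\<Sum>n=1..N. f n\<bar> \<le> B" and a: "a \<ge> 1"
    and g: "\<And>n. n \<ge> a \<Longrightarrow> g (Suc n) \<le> g n" "\<And>n. n \<ge> a \<Longrightarrow> g n \<ge> 0"
  shows "\<bar>\<Sum>n=a..N. f n * g n\<bar> \<le> 2 * B * g a"
proof -
  define A where "A N = (\<Sum>n=1..N. f n)" for N
  have A: "\<bar>A N\<bar> \<le> B" for N using B by (simp add: A_def)
  have "B \<ge> 0" using A[of 0] by (simp add: A_def)
  show ?thesis
  proof (cases "N \<ge> a")
    case True
    \<comment> \<open>The slack \<open>- g N\<close> makes the induction telescope, and at the end
      it pays for the boundary term \<open>A N * g N\<close>.\<close>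
    have "\<bar>(\<Sum>n=a..N. f n * g n) - A N * g N\<bar> \<le> B * (2 * g a - g N)"
      using True
    proof (induction N rule: dec_induct)
      case base
      have "A a = A (a - 1) + f a" using a by (cases a) (simp_all add: A_def)
      then have "f a * g a - A a * g a = - (A (a - 1) * g a)" by (simp add: algebra_simps)
      moreover have "\<bar>A (a - 1) * g a\<bar> \<le> B * g a"
        using A g(2)[of a] by (simp add: abs_mult mult_right_mono)
      ultimately show ?case by simp
    next
      case (step N)
      have "A (Suc N) = A N + f (Suc N)" by (simp add: A_def)
      then have "(\<Sum>n=a..Suc N. f n * g n) - A (Suc N) * g (Suc N) =
          ((\<Sum>n=a..N. f n * g n) - A N * g N) + A N * (g N - g (Suc N))"
        using step.hyps by (simp add: algebra_simps)
      moreover have "\<bar>A N * (g N - g (Suc N))\<bar> \<le> B * (g N - g (Suc N))"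
        using A g(1)[of N] step.hyps by (simp add: abs_mult mult_right_mono)
      ultimately show ?case using step.IH by (simp add: algebra_simps)
    qed
    moreover have "\<bar>A N * g N\<bar> \<le> B * g N"
      using A g(2)[of N] True by (simp add: abs_mult mult_right_mono)
    ultimately show ?thesis by (simp add: algebra_simps)
  next
    case False
    then show ?thesis using \<open>B \<ge> 0\<close> g(2)[of a] by simp
  qed
qed


section \<open>Nonprincipal real characters and their value L(1)\<close>

text \<open>A real Dirichlet character reduced to what the analysis uses. Bounded partial sums stand
  in for periodicity and exclude the principal character.\<close>

locale real_character =
  fixes f :: "nat \<Rightarrow> real" and B :: real
  assumes mult: "f (a * b) = f a * f b"
    and one: "f 1 = 1"
    and value_cases: "f n = 0 \<or> f n = 1 \<or> f n = -1"
    and partial_sums: "\<bar>\<Sum>n=1..N. f n\<bar> \<le> B"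
begin

lemma power: "f (a ^ k) = f a ^ k"
  using one by (induction k) (simp_all add: mult)

lemma B_nonneg: "B \<ge> 0"
  using partial_sums[of 0] by simp

text \<open>The convolution of \<open>f\<close> with the constant 1, that is, the coefficients of
  zeta(s) L(s, f).\<close>

definition divisor_sum :: "nat \<Rightarrow> real"
  where "divisor_sum n = (\<Sum>d | d dvd n. f d)"

lemma divisor_sum_mult:
  assumes "coprime a b"
  shows "divisor_sum (a * b) = divisor_sum a * divisor_sum b"
proof -
  have inj: "inj_on (\<lambda>(x, y). x * y) ({d. d dvd a} \<times> {d. d dvd b})"
  proof (rule inj_onI, clarsimp)
    fix x y x' y' assume d: "x dvd a" "y dvd b" "x' dvd a" "y' dvd b" and eq: "x * y = x' * y'"
    have c: "coprime x y'" "coprime x' y" "coprime y x'" "coprime y' x"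
      using d assms by (meson coprime_commute coprime_divisors)+
    have "x dvd x'" using c eq by (metis coprime_dvd_mult_left_iff dvd_triv_left)
    moreover have "x' dvd x" using c eq by (metis coprime_dvd_mult_left_iff dvd_triv_left)
    moreover have "y dvd y'" using c eq by (metis coprime_dvd_mult_right_iff dvd_triv_right)
    moreover have "y' dvd y" using c eq by (metis coprime_commute coprime_dvd_mult_right_iff dvd_triv_right)
    ultimately show "x = x' \<and> y = y'" by (simp add: dvd_antisym)
  qed
  have "{d. d dvd a * b} = (\<lambda>(x, y). x * y) ` ({d. d dvd a} \<times> {d. d dvd b})"
  proof (intro equalityI subsetI)
    fix d assume "d \<in> {d. d dvd a * b}"
    then obtain x y where "d = x * y" "x dvd a" "y dvd b" by (auto elim: dvd_productE)
    then show "d \<in> (\<lambda>(x, y). x * y) ` ({d. d dvd a} \<times> {d. d dvd b})" by auto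
  qed (auto intro: mult_dvd_mono)
  then have "divisor_sum (a * b) = (\<Sum>(x, y)\<in>{d. d dvd a} \<times> {d. d dvd b}. f (x * y))"
    unfolding divisor_sum_def using sum.reindex[OF inj, of f] by (simp only: o_def case_prod_unfold)
  also have "\<dots> = divisor_sum a * divisor_sum b"
    by (simp add: divisor_sum_def mult sum_product sum.cartesian_product)
  finally show ?thesis .
qed

text \<open>The value is 1 + f p + ... + (f p)^k. For \<open>f p = -1\<close> the terms cancel in
  pairs and leave 1 only for even k, which is why squares are singled out.\<close>

lemma divisor_sum_prime_power:
  assumes "prime p"
  shows "divisor_sum (p ^ k) \<ge> 0" "even k \<Longrightarrow> divisor_sum (p ^ k) \<ge> 1"
proof -
  have p: "p > 1" using assms by (rule prime_gt_1_nat)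
  have "{d. d dvd p ^ k} = (\<lambda>i. p ^ i) ` {..k}"
    using divides_primepow_nat[OF assms] by auto
  moreover have "inj_on (\<lambda>i. p ^ i) {..k}" using p by (auto intro: inj_onI)
  ultimately have eq: "divisor_sum (p ^ k) = (\<Sum>i\<le>k. f p ^ i)"
    by (simp add: divisor_sum_def sum.reindex power)
  have alt: "(\<Sum>i\<le>k. (-1) ^ i) = (if even k then 1 else 0 :: real)" for k :: nat
    by (induction k) auto
  have zero: "(\<Sum>i\<le>k. 0 ^ i) = (1 :: real)" for k :: nat
    by (induction k) auto
  show "divisor_sum (p ^ k) \<ge> 0" "even k \<Longrightarrow> divisor_sum (p ^ k) \<ge> 1"
    unfolding eq using value_cases[of p] alt[of k] zero[of k] by (elim disjE; simp)+
qed

lemma divisor_sum_bounds: "n > 0 \<Longrightarrow> divisor_sum n \<ge> 0 \<and> divisor_sum (n\<^sup>2) \<ge> 1"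
proof (induction n rule: less_induct)
  case (less n)
  show ?case
  proof (cases "n = 1")
    case True
    then show ?thesis using one by (simp add: divisor_sum_def)
  next
    case False
    then obtain p where p: "prime p" "p dvd n" using prime_factor_nat by blast
    have "n \<noteq> 0" "\<not> is_unit p" using less.prems p(1) not_prime_unit by auto
    then obtain m where m: "n = p ^ multiplicity p n * m" "\<not> p dvd m"
      by (rule multiplicity_decompose')
    define k where "k = multiplicity p n"
    have nm: "n = p ^ k * m" using m(1) by (simp add: k_def)
    have "k > 0" using p m unfolding k_def by (metis gr0I mult_1 power_0)
    have "m > 0" using nm less.prems by (cases m) auto
    moreover have "p ^ k > 1" by (rule one_less_power[OF prime_gt_1_nat[OF p(1)] \<open>k > 0\<close>])
    ultimately have "m < n" using nm by simp
    have cop: "coprime (p ^ k) m" using m(2) p(1) by (simp add: prime_imp_coprime coprime_power_left_iff)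
    have IH: "divisor_sum m \<ge> 0" "divisor_sum (m\<^sup>2) \<ge> 1" using less.IH[OF \<open>m < n\<close> \<open>m > 0\<close>] by simp_all
    have "divisor_sum n = divisor_sum (p ^ k) * divisor_sum m"
      unfolding nm using cop by (rule divisor_sum_mult)
    also have "\<dots> \<ge> 0" using divisor_sum_prime_power(1)[OF p(1)] IH(1) by simp
    finally have "divisor_sum n \<ge> 0" .
    moreover have "divisor_sum (n\<^sup>2) \<ge> 1"
    proof -
      have "n\<^sup>2 = p ^ (2 * k) * m\<^sup>2" by (simp add: nm power_mult_distrib power_mult power_even_eq mult.commute)
      moreover have "coprime (p ^ (2 * k)) (m\<^sup>2)" using m(2) p(1) by (simp add: prime_imp_coprime)
      ultimately have "divisor_sum (n\<^sup>2) = divisor_sum (p ^ (2 * k)) * divisor_sum (m\<^sup>2)"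
        by (simp add: divisor_sum_mult)
      also have "\<dots> \<ge> 1 * 1"
        using divisor_sum_prime_power(2)[OF p(1)] IH(2) by (intro mult_mono) (auto intro: order_trans[OF zero_le_one])
      finally show ?thesis by simp
    qed
    ultimately show ?thesis by blast
  qed
qed

definition S :: "nat \<Rightarrow> real"
  where "S N = (\<Sum>n=1..N. f n / real n)"

lemma S_tail:
  assumes "N \<le> M"
  shows "\<bar>S M - S N\<bar> \<le> 2 * B / real (Suc N)"
proof -
  have "{1..M} = {1..N} \<union> {Suc N..M}" using assms by auto
  then have "S M - S N = (\<Sum>n=Suc N..M. f n * (1 / real n))"
    by (simp add: S_def sum.union_disjoint)
  moreover have "\<bar>\<Sum>n=Suc N..M. f n * (1 / real n)\<bar> \<le> 2 * B * (1 / real (Suc N))"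
    by (rule abel_summation_bound[OF partial_sums]) (simp_all add: frac_le)
  ultimately show ?thesis by simp
qed

text \<open>The rate matters, not just convergence: at \<open>X div d\<close> it gives an error of
  order d / X, which Chebyshev's bound can sum over d.\<close>

lemma S_limit: "\<exists>L. \<forall>N. \<bar>S N - L\<bar> \<le> 2 * B / real (Suc N)"
proof -
  have lim: "(\<lambda>N. 2 * B / real (Suc N)) \<longlonglongrightarrow> 0"
    using LIMSEQ_Suc[OF lim_const_over_n[of "2 * B"]] by simp
  have "Cauchy S"
  proof (rule metric_CauchyI)
    fix e :: real assume "e > 0"
    then obtain N where N: "2 * B / real (Suc N) < e / 2"
      using order_tendstoD(2)[OF lim, of "e / 2"] by (auto simp: eventually_sequentially)
    have "dist (S m) (S n) < e" if "m \<ge> N" "n \<ge> N" for m n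
      using S_tail[OF that(1)] S_tail[OF that(2)] N unfolding dist_real_def by linarith
    then show "\<exists>M. \<forall>m\<ge>M. \<forall>n\<ge>M. dist (S m) (S n) < e" by blast
  qed
  then obtain L where L: "S \<longlonglongrightarrow> L" using Cauchy_convergent convergent_def by blast
  have "\<bar>S N - L\<bar> \<le> 2 * B / real (Suc N)" for N
  proof (rule LIMSEQ_le_const2)
    show "(\<lambda>M. \<bar>S N - S M\<bar>) \<longlonglongrightarrow> \<bar>S N - L\<bar>" by (intro tendsto_intros L)
    show "\<exists>M. \<forall>n\<ge>M. \<bar>S N - S n\<bar> \<le> 2 * B / real (Suc N)"
      using S_tail by (metis abs_minus_commute)
  qed
  then show ?thesis by blast
qed

end

section \<open>Nonvanishing of L(1)\<close>

lemma geometric_sum_ge: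
  assumes "0 < t" "t < (1::real)"
  shows "real n * t ^ n \<le> (\<Sum>i<n. t ^ i)"
proof -
  have "(\<Sum>i<n. t ^ n) \<le> (\<Sum>i<n. t ^ i)"
    using assms by (intro sum_mono power_decreasing) auto
  then show ?thesis by simp
qed

text \<open>Pairing t^i with t^(n-1-i) by the arithmetic-geometric mean inequality bounds each
  factor below by its length times a power of \<open>u = sqrt t\<close>. The product then carries
  u^(2n-1), which is at least t^n. This inequality is what makes Monsky's weights decrease.\<close>

lemma geometric_sum_product_ge:
  assumes t: "0 < t" "t < (1::real)"
  shows "real n * real (Suc n) * t ^ n \<le> (\<Sum>i<n. t ^ i) * (\<Sum>i<Suc n. t ^ i)"
proof -
  define u where "u = sqrt t"
  have u: "0 < u" "u < 1" "t = u\<^sup>2" using t by (simp_all add: u_def)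
  have AMGM: "real n * u ^ (n - 1) \<le> (\<Sum>i<n. t ^ i)" for n
  proof -
    have "(\<Sum>i<n. 2 * u ^ (n - 1)) \<le> (\<Sum>i<n. t ^ i + t ^ (n - 1 - i))"
    proof (rule sum_mono)
      fix i assume "i \<in> {..<n}"
      then have "u ^ (n - 1) = u ^ i * u ^ (n - 1 - i)" by (simp flip: power_add)
      moreover have "t ^ i = (u ^ i)\<^sup>2" "t ^ (n - 1 - i) = (u ^ (n - 1 - i))\<^sup>2"
        by (simp_all add: u(3) mult.commute flip: power_mult)
      ultimately show "2 * u ^ (n - 1) \<le> t ^ i + t ^ (n - 1 - i)"
        using sum_squares_bound[of "u ^ i" "u ^ (n - 1 - i)"] by simp
    qed
    also have "\<dots> = (\<Sum>i<n. t ^ i) + (\<Sum>i<n. t ^ (n - Suc i))" by (simp add: sum.distrib)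
    also have "(\<Sum>i<n. t ^ (n - Suc i)) = (\<Sum>i<n. t ^ i)" by (rule sum.nat_diff_reindex)
    finally show ?thesis by simp
  qed
  show ?thesis
  proof (cases n)
    case (Suc m)
    have "t ^ n = u ^ (2 * n)" by (simp add: u(3) power_mult)
    also have "\<dots> \<le> u ^ ((n - 1) + n)" using u by (intro power_decreasing) auto
    finally have "t ^ n \<le> u ^ (n - 1) * u ^ n" by (simp add: power_add)
    then have "real n * real (Suc n) * t ^ n \<le> real n * real (Suc n) * (u ^ (n - 1) * u ^ n)"
      by (intro mult_left_mono) auto
    also have "\<dots> = (real n * u ^ (n - 1)) * (real (Suc n) * u ^ (Suc n - 1))" by simp
    also have "\<dots> \<le> (\<Sum>i<n. t ^ i) * (\<Sum>i<Suc n. t ^ i)"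
      using u t by (intro mult_mono AMGM sum_nonneg) auto
    finally show ?thesis .
  qed simp
qed


context real_character
begin

text \<open>Monsky's argument: if \<open>L = 0\<close>, then the Lambert series of \<open>f\<close> at \<open>t\<close>, which is
  \<open>\<Sum>j. divisor_sum j * t ^ j\<close>, can be compared with \<open>\<Sum>n. f n / (n * (1 - t)) = 0\<close>.
  The difference has monotone weights with value \<open>1\<close> at \<open>n = 1\<close>, so it stays bounded as \<open>t\<close> tends
  to \<open>1\<close>, whereas the square indices \<open>j\<close> alone make the Lambert series unbounded.\<close>
lemma theta_sum_bounded:
  assumes S0: "\<And>N. \<bar>S N\<bar> \<le> 2 * B / real (Suc N)" and t: "0 < t" "t < 1"
  shows "real K * t ^ (K\<^sup>2) \<le> 2 * B"
proof -
  define G where "G n = (\<Sum>i<n. t ^ i)" for n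
  define b where "b n = (1 / real n - t ^ n / G n) / (1 - t)" for n
  define T where "T n = t ^ n / (1 - t ^ n)" for n
  have G_pos: "G n > 0" if "n > 0" for n
    unfolding G_def using that t by (intro sum_pos) auto
  have G_Suc: "G (Suc n) = 1 + t * G n" for n
    unfolding G_def by (subst sum.lessThan_Suc_shift) (simp add: sum_distrib_left)
  have geom: "1 - t ^ n = (1 - t) * G n" for n
    unfolding G_def by (rule one_diff_power_eq)
  have T_eq: "T n = 1 / real n / (1 - t) - b n" if "n > 0" for n
    using G_pos[OF that] t that by (simp add: T_def b_def geom diff_divide_distrib)
  have b_nonneg: "b n \<ge> 0" if "n \<ge> 1" for n
  proof -
    have "real n * t ^ n \<le> G n" unfolding G_def using t by (rule geometric_sum_ge)
    then have "t ^ n / G n \<le> 1 / real n" using G_pos[of n] that by (simp add: field_simps)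
    then show ?thesis using t by (simp add: b_def)
  qed
  have b_dec: "b (Suc n) \<le> b n" if "n \<ge> 1" for n
  proof -
    have pos: "G n > 0" "G (Suc n) > 0" using G_pos that by auto
    have "t ^ n / G n - t ^ Suc n / G (Suc n) = t ^ n * (G (Suc n) - t * G n) / (G n * G (Suc n))"
      using pos by (simp add: field_simps)
    also have "\<dots> = t ^ n / (G n * G (Suc n))" by (simp add: G_Suc)
    also have "\<dots> \<le> 1 / (real n * real (Suc n))"
    proof -
      have "real n * real (Suc n) * t ^ n \<le> G n * G (Suc n)"
        unfolding G_def using t by (rule geometric_sum_product_ge)
      moreover have "0 < real n * real (Suc n)" "0 < G n * G (Suc n)" using that pos by simp_all
      ultimately show ?thesis by (simp add: divide_le_eq le_divide_eq mult.commute)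
    qed
    also have "\<dots> = 1 / real n - 1 / real (Suc n)" using that by (simp add: field_simps)
    finally have "1 / real (Suc n) - t ^ Suc n / G (Suc n) \<le> 1 / real n - t ^ n / G n" by linarith
    then show ?thesis unfolding b_def using t by (intro divide_right_mono) auto
  qed
  have "b 1 = 1" using t by (simp add: b_def G_def)
  have upper: "(\<Sum>n=1..X. f n * T n) \<le> 2 * B / real (Suc X) / (1 - t) + 2 * B" for X
  proof -
    have "(\<Sum>n=1..X. f n * T n) = (\<Sum>n=1..X. f n / real n / (1 - t) - f n * b n)"
      by (intro sum.cong refl) (simp add: T_eq right_diff_distrib)
    also have "\<dots> = S X / (1 - t) - (\<Sum>n=1..X. f n * b n)"
      by (simp add: sum_subtractf S_def sum_divide_distrib)
    finally have "(\<Sum>n=1..X. f n * T n) = S X / (1 - t) - (\<Sum>n=1..X. f n * b n)" .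
    moreover have "\<bar>\<Sum>n=1..X. f n * b n\<bar> \<le> 2 * B * b 1"
      by (rule abel_summation_bound[OF partial_sums]) (use b_dec b_nonneg in simp_all)
    moreover have "S X / (1 - t) \<le> 2 * B / real (Suc X) / (1 - t)"
      using S0[of X] t by (intro divide_right_mono) auto
    ultimately show ?thesis using \<open>b 1 = 1\<close> by simp
  qed
  \<comment> \<open>All sums stay finite. Cutting the geometric series for n after
    \<open>X div n\<close> terms costs at most t^X / (1 - t), so the total loss X t^X / (1 - t)
    disappears as X grows.\<close>
  have lower: "real K * t ^ (K\<^sup>2) \<le> (\<Sum>n=1..X. f n * T n) + real X * t ^ X / (1 - t)" if "X \<ge> K\<^sup>2" for X
  proof -
    have summand: "(\<Sum>k=1..X div n. f n * t ^ (n * k)) \<le> f n * T n + t ^ X / (1 - t)" if "n \<in> {1..X}" for n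
    proof -
      define m y where "m = X div n" and "y = t ^ n"
      have y: "0 < y" "y < 1" "y \<le> t" using t that power_decreasing[of 1 n t]
        by (auto simp: y_def power_Suc_less_one intro: power_less_one_iff[THEN iffD2])
      have "(1 - y) * (\<Sum>k=1..m. y ^ k) = y - y ^ Suc m" for m
      proof (induction m)
        case (Suc m)
        have "(1 - y) * (\<Sum>k=1..Suc m. y ^ k) = (1 - y) * (\<Sum>k=1..m. y ^ k) + (1 - y) * y ^ Suc m"
          by (simp add: distrib_left)
        also have "\<dots> = y - y ^ Suc (Suc m)" unfolding Suc by (simp add: algebra_simps)
        finally show ?case .
      qed simp
      then have "(\<Sum>k=1..m. y ^ k) = (y - y ^ Suc m) / (1 - y)" using y by (simp add: field_simps)
      then have eq: "(\<Sum>k=1..m. y ^ k) = T n - y ^ Suc m / (1 - y)" by (simp add: T_def y_def diff_divide_distrib)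
      have "X < n * Suc m" using that dividend_less_div_times[of n X] by (simp add: m_def mult.commute)
      then have "y ^ Suc m \<le> t ^ X" unfolding y_def power_mult[symmetric] using t by (intro power_decreasing) auto
      then have R: "0 \<le> y ^ Suc m / (1 - y)" "y ^ Suc m / (1 - y) \<le> t ^ X / (1 - t)"
        using y t by (auto intro!: frac_le)
      have "(\<Sum>k=1..X div n. f n * t ^ (n * k)) = f n * (\<Sum>k=1..m. y ^ k)"
        by (simp add: m_def y_def sum_distrib_left power_mult)
      also have "\<dots> = f n * T n - f n * (y ^ Suc m / (1 - y))" unfolding eq by (simp only: right_diff_distrib)
      also have "\<dots> \<le> f n * T n + y ^ Suc m / (1 - y)"
        using value_cases[of n] R(1) by (elim disjE) simp_all
      finally show ?thesis using R(2) by linarith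
    qed
    have "real K * t ^ (K\<^sup>2) = (\<Sum>k=1..K. t ^ (K\<^sup>2))" by simp
    also have "\<dots> \<le> (\<Sum>k=1..K. divisor_sum (k\<^sup>2) * t ^ (k\<^sup>2))"
    proof (rule sum_mono)
      fix k assume k: "k \<in> {1..K}"
      then have "t ^ (K\<^sup>2) \<le> t ^ (k\<^sup>2)" using t by (intro power_decreasing power_mono) auto
      also have "\<dots> \<le> divisor_sum (k\<^sup>2) * t ^ (k\<^sup>2)"
        using divisor_sum_bounds[of k] k t by (simp add: mult_le_cancel_right1)
      finally show "t ^ (K\<^sup>2) \<le> divisor_sum (k\<^sup>2) * t ^ (k\<^sup>2)" .
    qed
    also have "\<dots> = (\<Sum>j\<in>power2 ` {1..K}. divisor_sum j * t ^ j)"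
      by (subst sum.reindex) (auto intro!: inj_onI)
    also have "\<dots> \<le> (\<Sum>j=1..X. divisor_sum j * t ^ j)"
    proof (rule sum_mono2)
      show "power2 ` {1..K} \<subseteq> {1..X}"
      proof (rule image_subsetI)
        fix k assume k: "k \<in> {1..K}"
        then have "k\<^sup>2 \<le> K\<^sup>2" by (intro power_mono) auto
        then have "k\<^sup>2 \<le> X" using \<open>K\<^sup>2 \<le> X\<close> by linarith
        then show "k\<^sup>2 \<in> {1..X}" using k by (simp add: Suc_le_eq)
      qed
      show "0 \<le> divisor_sum j * t ^ j" if "j \<in> {1..X} - power2 ` {1..K}" for j
        using divisor_sum_bounds[of j] that t by simp
    qed simp
    also have "\<dots> = (\<Sum>j=1..X. \<Sum>d | d dvd j. f d * t ^ (d * (j div d)))"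
      by (simp add: divisor_sum_def sum_distrib_right)
    also have "\<dots> = (\<Sum>n=1..X. \<Sum>k=1..X div n. f n * t ^ (n * k))"
      by (rule sum_hyperbola[symmetric])
    also have "\<dots> \<le> (\<Sum>n=1..X. f n * T n + t ^ X / (1 - t))"
      by (rule sum_mono) (rule summand)
    also have "\<dots> = (\<Sum>n=1..X. f n * T n) + real X * t ^ X / (1 - t)"
      by (simp add: sum.distrib)
    finally show ?thesis .
  qed
  have "(\<lambda>X. real X * t ^ X / (1 - t) + (2 * B / real (Suc X) / (1 - t) + 2 * B)) \<longlonglongrightarrow> 0 / (1 - t) + (0 / (1 - t) + 2 * B)"
  proof (intro tendsto_intros)
    show "(\<lambda>X. real X * t ^ X) \<longlonglongrightarrow> 0" using powser_times_n_limit_0[of t] t by simp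
    show "(\<lambda>X. 2 * B / real (Suc X)) \<longlonglongrightarrow> 0" using LIMSEQ_Suc[OF lim_const_over_n[of "2 * B"]] by simp
  qed (use t in auto)
  moreover have "real K * t ^ (K\<^sup>2) \<le> real X * t ^ X / (1 - t) + (2 * B / real (Suc X) / (1 - t) + 2 * B)"
    if "X \<ge> K\<^sup>2" for X
    using lower[OF that] upper[of X] by linarith
  ultimately have "real K * t ^ (K\<^sup>2) \<le> 0 / (1 - t) + (0 / (1 - t) + 2 * B)"
    by (intro LIMSEQ_le_const) blast+
  then show ?thesis by simp
qed

lemma S_limit_nonzero:
  assumes "\<And>N. \<bar>S N - L\<bar> \<le> 2 * B / real (Suc N)"
  shows "L \<noteq> 0"
proof
  assume "L = 0"
  then have S0: "\<bar>S N\<bar> \<le> 2 * B / real (Suc N)" for N using assms[of N] by simp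
  \<comment> \<open>With t = 1 - 1 / (2 K^2), Bernoulli's inequality keeps t^(K^2) at least 1/2, so
    the bounded theta sum would give K / 2 <= 2 B.\<close>
  obtain K where K: "real K > 4 * B" "K \<ge> 1"
    using reals_Archimedean2[of "max (4 * B) 1"] by (metis max_less_iff_conj of_nat_1 of_nat_less_iff less_imp_le)
  define s where "s = real (K\<^sup>2)"
  define t where "t = 1 + - 1 / (2 * s)"
  have "K\<^sup>2 \<ge> 1" using K(2) by simp
  then have s: "s \<ge> 1" unfolding s_def by (metis of_nat_1 of_nat_le_iff)
  then have "1 / (2 * s) \<le> 1 / 2" "1 / (2 * s) > 0" by (simp_all add: divide_le_eq)
  then have t: "0 < t" "t < 1" "- 1 / (2 * s) \<ge> -1" by (simp_all add: t_def)
  have "1 / 2 = 1 + s * (- 1 / (2 * s))" using s by simp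
  also have "\<dots> \<le> t ^ (K\<^sup>2)" unfolding t_def s_def by (rule Bernoulli_inequality) (use t(3) in \<open>simp add: s_def\<close>)
  finally have "real K * (1 / 2) \<le> real K * t ^ (K\<^sup>2)" by (intro mult_left_mono) auto
  also have "\<dots> \<le> 2 * B" by (rule theta_sum_bounded[OF S0 t(1,2)])
  finally show False using K by simp
qed

text \<open>Mertens' argument: writing ln as a divisor sum turns the bounded sum of f n ln n / n
  into the sum of f d mangoldt d / d times \<open>S (X div d)\<close>. Replacing each
  \<open>S\<close> by \<open>L\<close> costs a bounded amount by Chebyshev's bound, and what remains
  is divided by \<open>L\<close>, which is nonzero.\<close>

lemma mangoldt_sum_bounded: "\<exists>C. \<forall>X. \<bar>\<Sum>d=1..X. f d * mangoldt d / real d\<bar> \<le> C"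
proof -
  obtain L where L: "\<And>N. \<bar>S N - L\<bar> \<le> 2 * B / real (Suc N)" using S_limit by blast
  have L0: "L \<noteq> 0" using L by (rule S_limit_nonzero)
  define C0 where "C0 = 2 * B * (ln 3 / 3) + ln 2"
  \<comment> \<open>ln x / x decreases only from e on, so summation by parts starts at 3; the terms
    for 1 and 2 contribute at most ln 2.\<close>
  have ln_sum: "\<bar>\<Sum>n=1..X. f n * (ln (real n) / real n)\<bar> \<le> C0" for X
  proof -
    have "\<bar>\<Sum>n=3..X. f n * (ln (real n) / real n)\<bar> \<le> 2 * B * (ln (real 3) / real 3)"
    proof (rule abel_summation_bound[OF partial_sums])
      fix n :: nat assume "n \<ge> 3"
      then have "exp 1 \<le> real n" using exp_le by linarith
      then show "ln (real (Suc n)) / real (Suc n) \<le> ln (real n) / real n" by (intro ln_x_over_x_mono) auto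
    qed simp_all
    moreover have "\<bar>(\<Sum>n=1..X. f n * (ln (real n) / real n)) - (\<Sum>n=3..X. f n * (ln (real n) / real n))\<bar> \<le> ln 2"
    proof (cases "X \<ge> 2")
      case True
      then have "{1..X} = {1, 2} \<union> {3..X}" by auto
      then have "(\<Sum>n=1..X. f n * (ln (real n) / real n)) = f 2 * (ln 2 / 2) + (\<Sum>n=3..X. f n * (ln (real n) / real n))"
        by (simp add: sum.union_disjoint)
      moreover have "\<bar>f 2 * (ln 2 / 2)\<bar> \<le> ln 2" using value_cases[of 2] by (elim disjE) simp_all
      ultimately show ?thesis by simp
    next
      case False
      then have "X = 0 \<or> X = 1" by auto
      then show ?thesis by auto
    qed
    ultimately show ?thesis unfolding C0_def by simp
  qed
  define c where "c = 2 * B * (2 * ln (4::real))"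
  have c: "c \<ge> 0" using B_nonneg by (simp add: c_def)
  have "\<bar>\<Sum>d=1..X. f d * mangoldt d / real d\<bar> \<le> (C0 + c) / \<bar>L\<bar>" for X
  proof -
    define M where "M = (\<Sum>d=1..X. f d * mangoldt d / real d)"
    have "(\<Sum>n=1..X. f n * (ln (real n) / real n)) = (\<Sum>j=1..X. \<Sum>d | d dvd j. f j / real j * mangoldt d)"
    proof (intro sum.cong refl)
      fix j assume "j \<in> {1..X}"
      then have "(\<Sum>d | d dvd j. mangoldt d) = ln (real j)" by (simp add: mangoldt_sum)
      then show "f j * (ln (real j) / real j) = (\<Sum>d | d dvd j. f j / real j * mangoldt d)"
        unfolding sum_distrib_left[symmetric] by simp
    qed
    also have "\<dots> = (\<Sum>j=1..X. \<Sum>d | d dvd j. f (d * (j div d)) / real (d * (j div d)) * mangoldt d)"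
      by (intro sum.cong refl) simp
    also have "\<dots> = (\<Sum>d=1..X. \<Sum>k=1..X div d. f (d * k) / real (d * k) * mangoldt d)"
      by (rule sum_hyperbola[symmetric])
    also have "\<dots> = (\<Sum>d=1..X. f d * mangoldt d / real d * S (X div d))"
      by (simp add: S_def mult sum_distrib_left mult_ac)
    also have "\<dots> = M * L + (\<Sum>d=1..X. f d * mangoldt d / real d * (S (X div d) - L))"
      unfolding M_def sum_distrib_right sum.distrib[symmetric]
      by (intro sum.cong refl) (simp add: right_diff_distrib)
    finally have eq: "(\<Sum>n=1..X. f n * (ln (real n) / real n)) = M * L + (\<Sum>d=1..X. f d * mangoldt d / real d * (S (X div d) - L))" .
    have "\<bar>\<Sum>d=1..X. f d * mangoldt d / real d * (S (X div d) - L)\<bar> \<le> (\<Sum>d=1..X. 2 * B / real X * mangoldt d)"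
    proof (rule order_trans[OF sum_abs], rule sum_mono)
      fix d assume d: "d \<in> {1..X}"
      have "X \<le> d * Suc (X div d)" using d dividend_less_div_times[of d X] by (simp add: mult.commute)
      then have "real X \<le> real d * real (Suc (X div d))" by (metis of_nat_le_iff of_nat_mult)
      then have "1 / real (Suc (X div d)) \<le> real d / real X"
        using d by (simp add: field_simps)
      then have "2 * B * (1 / real (Suc (X div d))) \<le> 2 * B * (real d / real X)"
        using B_nonneg by (intro mult_left_mono) auto
      then have "2 * B / real (Suc (X div d)) \<le> 2 * B * (real d / real X)" by simp
      then have e: "\<bar>S (X div d) - L\<bar> \<le> 2 * B * (real d / real X)" using L[of "X div d"] by linarith
      have "\<bar>f d\<bar> \<le> 1" using value_cases[of d] by auto
      then have "\<bar>f d * mangoldt d / real d\<bar> \<le> mangoldt d / real d"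
        by (simp add: abs_mult divide_right_mono mult_left_le_one_le mangoldt_nonneg)
      then have "\<bar>f d * mangoldt d / real d\<bar> * \<bar>S (X div d) - L\<bar> \<le> mangoldt d / real d * (2 * B * (real d / real X))"
        using e by (intro mult_mono) (auto simp: mangoldt_nonneg)
      also have "\<dots> = 2 * B / real X * mangoldt d" using d by (simp add: field_simps)
      finally show "\<bar>f d * mangoldt d / real d * (S (X div d) - L)\<bar> \<le> 2 * B / real X * mangoldt d"
        by (simp add: abs_mult)
    qed
    also have "\<dots> = 2 * B / real X * (\<Sum>d=1..X. mangoldt d)" by (simp add: sum_distrib_left)
    also have "\<dots> \<le> 2 * B / real X * (2 * ln 4 * real X)"
      using sum_mangoldt_le B_nonneg by (intro mult_left_mono) auto
    also have "\<dots> \<le> c" using c by (cases "X = 0") (simp_all add: c_def)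
    finally have "\<bar>M * L\<bar> \<le> C0 + c" using eq ln_sum[of X] by linarith
    then show ?thesis using L0 by (simp add: M_def abs_mult le_divide_eq)
  qed
  then show ?thesis by blast
qed

end

section \<open>Primes with prescribed Legendre symbols\<close>

lemma Legendre_values: "Legendre a p = 0 \<or> Legendre a p = 1 \<or> Legendre a p = -1"
  by (simp add: Legendre_def)

lemma Legendre_cong:
  assumes "[a = b] (mod p)"
  shows "Legendre a p = Legendre b p"
proof -
  have "[a = c] (mod p) \<longleftrightarrow> [b = c] (mod p)" "[c = a] (mod p) \<longleftrightarrow> [c = b] (mod p)" for c
    using assms by (meson cong_sym cong_trans)+
  then show ?thesis by (simp add: Legendre_def QuadRes_def)
qed

lemma Legendre_mult:
  fixes p :: nat
  assumes "prime p" "p > 2"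
  shows "Legendre (a * b) p = Legendre a p * Legendre b p"
proof -
  have "[Legendre a p * Legendre b p = a ^ ((p - 1) div 2) * b ^ ((p - 1) div 2)] (mod p)"
    by (intro cong_mult euler_criterion assms)
  moreover have "[Legendre (a * b) p = (a * b) ^ ((p - 1) div 2)] (mod p)"
    by (intro euler_criterion assms)
  ultimately have "[Legendre (a * b) p = Legendre a p * Legendre b p] (mod p)"
    unfolding power_mult_distrib by (meson cong_sym cong_trans)
  then have d: "int p dvd Legendre (a * b) p - Legendre a p * Legendre b p"
    by (simp add: cong_iff_dvd_diff)
  \<comment> \<open>Both sides lie in {-1, 0, 1} and differ by at most 2, so for p > 2 congruence
    modulo p is equality.\<close>
  have "\<bar>Legendre (a * b) p - Legendre a p * Legendre b p\<bar> < int p"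
    using Legendre_values[of a p] Legendre_values[of b p] Legendre_values[of "a * b" p] assms(2)
    by (elim disjE) simp_all
  then show ?thesis using dvd_imp_le_int[OF _ d] by fastforce
qed

lemma Legendre_one: "p > 1 \<Longrightarrow> Legendre 1 p = 1"
  by (auto simp: Legendre_def QuadRes_def cong_def intro!: exI[of _ 1])

text \<open>Squaring identifies 1 and p - 1 modulo p, so it is not injective on the residues and
  hence not surjective. A missed residue is nonzero because 0 is a square.\<close>

lemma exists_nonresidue:
  fixes p :: nat
  assumes "prime p" "p > 2"
  obtains a :: nat where "Legendre a p = -1"
proof -
  define h where "h = (\<lambda>x::nat. x\<^sup>2 mod p)"
  have "h 1 = h (p - 1)"
  proof -
    have "[(int p - 1)\<^sup>2 = 1] (mod int p)"
      by (simp add: cong_iff_dvd_diff power2_eq_square algebra_simps)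
    moreover have "int (p - 1) = int p - 1" using assms(2) by simp
    ultimately have "[(p - 1)\<^sup>2 = 1] (mod p)" by (metis cong_int_iff of_nat_1 of_nat_power)
    then show ?thesis using assms(2) by (simp add: h_def cong_def)
  qed
  moreover have "1 \<in> {..<p}" "p - 1 \<in> {..<p}" "1 \<noteq> p - 1" using assms(2) by auto
  ultimately have "\<not> inj_on h {..<p}" by (meson inj_onD)
  then have "\<not> {..<p} \<subseteq> h ` {..<p}" using finite_surj_inj[of "{..<p}" h] by blast
  then obtain a where a: "a < p" "a \<notin> h ` {..<p}" by auto
  have "\<not> [int a = 0] (mod int p)"
  proof
    assume "[int a = 0] (mod int p)"
    then have "a = h 0" using a(1) by (simp add: h_def cong_def)
    then show False using a by auto
  qed
  moreover have "\<not> QuadRes p a"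
  proof
    assume "QuadRes p a"
    then obtain y where y: "[y\<^sup>2 = int a] (mod int p)" by (auto simp: QuadRes_def)
    define z where "z = nat (y mod int p)"
    have z: "int z = y mod int p" "z < p" using assms(2) by (simp_all add: z_def nat_less_iff)
    have "int (h z) = int a mod int p"
      using y by (simp add: h_def zmod_int z power_mod cong_def)
    then have "h z = a" using a(1) by (simp flip: zmod_int)
    then show False using a z by auto
  qed
  ultimately show thesis using that[of a] by (simp add: Legendre_def)
qed

lemma periodic_partial_sums:
  fixes f :: "nat \<Rightarrow> real"
  assumes per: "\<And>n. f (n + M) = f n" and zero: "(\<Sum>n<M. f n) = 0" and bound: "\<And>n. \<bar>f n\<bar> \<le> 1" and M: "M > 0"
  shows "\<bar>\<Sum>n=1..N. f n\<bar> \<le> real M + 1"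
proof -
  have shift: "(\<Sum>n<N + M. f n) = (\<Sum>n<N. f n)" for N
    by (induction N) (simp_all add: zero per)
  have small: "\<bar>\<Sum>n<N. f n\<bar> \<le> real N" for N
  proof -
    have "\<bar>\<Sum>n<N. f n\<bar> \<le> (\<Sum>n<N. 1)" by (rule order_trans[OF sum_abs sum_mono]) (rule bound)
    then show ?thesis by simp
  qed
  have "\<bar>\<Sum>n<N. f n\<bar> \<le> real M" for N
  proof (induction N rule: less_induct)
    case (less N)
    show ?case
    proof (cases "N < M")
      case True
      then show ?thesis using small[of N] by simp
    next
      case False
      then show ?thesis using less[of "N - M"] M shift[of "N - M"] by simp
    qed
  qed
  from this[of "Suc N"] have "\<bar>\<Sum>n<Suc N. f n\<bar> \<le> real M" .
  moreover have "(\<Sum>n<Suc N. f n) = f 0 + (\<Sum>n=1..N. f n)"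
    by (simp add: lessThan_Suc_atMost atMost_atLeast0 sum.atLeast_Suc_atMost)
  ultimately show ?thesis using bound[of 0] by linarith
qed

text \<open>These characters arise when the detector product below is expanded over subsets of
  primes. The empty set gives the constant 1 and thereby the main term.\<close>

definition Legendre_product :: "nat set \<Rightarrow> nat \<Rightarrow> real"
  where "Legendre_product P n = (\<Prod>p\<in>P. of_int (Legendre (int n) (int p)))"

text \<open>The Chinese remainder theorem combines a nonresidue modulo one prime with 1 modulo the
  others into some \<open>a\<close> of value -1. Multiplication by \<open>a\<close> permutes the
  residues modulo the product of \<open>P\<close>, so the sum over a period equals its own
  negative.\<close>

lemma Legendre_product_character:
  assumes P: "finite P" "P \<noteq> {}" "\<And>p. p \<in> P \<Longrightarrow> prime p \<and> p > 2"
  shows "real_character (Legendre_product P) (real (\<Prod>P) + 1)"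
proof
  have mult: "Legendre_product P (a * b) = Legendre_product P a * Legendre_product P b" for a b
    using P(3) by (auto simp: Legendre_product_def Legendre_mult simp flip: prod.distrib intro!: prod.cong)
  then show "Legendre_product P (a * b) = Legendre_product P a * Legendre_product P b" for a b .
  have Legendre_1: "Legendre 1 (int p) = 1" if "p \<in> P" for p
    using P(3)[OF that] by (intro Legendre_one) simp
  then show "Legendre_product P 1 = 1"
    by (simp add: Legendre_product_def)
  have vals: "Legendre_product Q n \<in> {0, 1, -1}" if "finite Q" for n Q
    using that
  proof (induction Q rule: finite_induct)
    case (insert p Q)
    then show ?case using Legendre_values[of "int n" "int p"]
      by (auto simp: Legendre_product_def)
  qed (simp add: Legendre_product_def)
  then show "Legendre_product P n = 0 \<or> Legendre_product P n = 1 \<or> Legendre_product P n = -1" for n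
    using P(1) by blast
  define M where "M = \<Prod>P"
  have M: "M > 0" unfolding M_def using P by (intro prod_pos) (auto simp: prime_gt_0_nat)
  have cong: "Legendre_product P a = Legendre_product P b" if "[a = b] (mod M)" for a b
    unfolding Legendre_product_def
  proof (intro prod.cong refl arg_cong[of _ _ of_int] Legendre_cong)
    fix p assume "p \<in> P"
    then have "p dvd M" unfolding M_def using P(1) by (rule dvd_prodI[OF _ , rotated])
    then have "[a = b] (mod p)" using that by (rule cong_dvd_modulus_nat[rotated])
    then show "[int a = int b] (mod int p)" by (simp add: cong_int_iff)
  qed
  obtain p where p: "p \<in> P" using P(2) by blast
  obtain g :: nat where g: "Legendre g p = -1" using exists_nonresidue P(3)[OF p] by blast
  have "coprime p (\<Prod>(P - {p}))"
    using P p by (intro prod_coprime_right) (auto simp: primes_coprime)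
  from binary_chinese_remainder_nat[OF this, of g 1]
  obtain a where a: "[a = g] (mod p)" "[a = 1] (mod \<Prod>(P - {p}))" by blast
  have a1: "Legendre a q = 1" if "q \<in> P - {p}" for q
  proof -
    have "q dvd \<Prod>(P - {p})" using that P(1) by (intro dvd_prodI) auto
    then have "[a = 1] (mod q)" using a(2) by (rule cong_dvd_modulus_nat[rotated])
    then have "[int a = 1] (mod int q)" by (metis cong_int_iff of_nat_1)
    then have "Legendre a q = Legendre 1 q" by (rule Legendre_cong)
    then show ?thesis using Legendre_1 that by simp
  qed
  have "Legendre a p = -1"
    using g Legendre_cong[of "int a" "int g" "int p"] a(1) by (simp add: cong_int_iff)
  then have chi_a: "Legendre_product P a = -1"
    using a1 by (simp add: Legendre_product_def prod.remove[OF P(1) p])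
  have "coprime a M"
  proof -
    have "coprime a q" if "q \<in> P" for q
    proof -
      have "\<not> q dvd a"
      proof
        assume "q dvd a"
        then have "Legendre a q = 0" by (simp add: Legendre_def cong_0_iff)
        then show False using a1[of q] \<open>Legendre a p = -1\<close> that by (cases "q = p") auto
      qed
      then show ?thesis using P(3)[OF that] by (metis coprime_commute prime_imp_coprime)
    qed
    then show ?thesis unfolding M_def by (intro prod_coprime_right) auto
  qed
  have inj: "inj_on (\<lambda>n. a * n mod M) {..<M}"
  proof (rule inj_onI)
    fix x y assume xy: "x \<in> {..<M}" "y \<in> {..<M}" "a * x mod M = a * y mod M"
    then have "[a * x = a * y] (mod M)" by (simp add: cong_def)
    then have "[x = y] (mod M)" using \<open>coprime a M\<close> by (simp add: cong_mult_lcancel_nat)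
    then show "x = y" using xy by (simp add: cong_def)
  qed
  have "(\<lambda>n. a * n mod M) ` {..<M} = {..<M}"
    by (rule endo_inj_surj[OF _ _ inj]) (use M in auto)
  then have "(\<Sum>n<M. Legendre_product P n) = (\<Sum>n\<in>(\<lambda>n. a * n mod M) ` {..<M}. Legendre_product P n)" by simp
  also have "\<dots> = (\<Sum>n<M. Legendre_product P (a * n mod M))"
    by (simp add: sum.reindex[OF inj])
  also have "\<dots> = (\<Sum>n<M. Legendre_product P a * Legendre_product P n)"
    by (intro sum.cong refl) (simp flip: mult add: cong[of "a * _ mod M" "a * _"])
  also have "\<dots> = - (\<Sum>n<M. Legendre_product P n)" by (simp add: chi_a sum_negf)
  finally have zero: "(\<Sum>n<M. Legendre_product P n) = 0" by simp
  have "\<bar>\<Sum>n=1..N. Legendre_product P n\<bar> \<le> real M + 1" for N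
  proof (rule periodic_partial_sums[OF _ zero _ M])
    show "Legendre_product P (n + M) = Legendre_product P n" for n by (rule cong) (simp add: cong_def)
    show "\<bar>Legendre_product P n\<bar> \<le> 1" for n using vals[OF P(1), of n] by auto
  qed
  then show "\<bar>\<Sum>n=1..N. Legendre_product P n\<bar> \<le> real (\<Prod>P) + 1" for N by (simp add: M_def)
qed

text \<open>Controls the powers of the primes in \<open>P\<close> themselves, where only the crude
  bound \<open>F n \<le> c\<close> is available. The exponent 0 is included, hence 2 instead of
  1.\<close>

lemma sum_prime_powers_le:
  fixes q :: nat
  assumes "q \<ge> 2"
  shows "(\<Sum>n\<in>{n\<in>{1..X}. \<exists>k. n = q ^ k}. 1 / real n) \<le> 2"
proof -
  have sub: "{n\<in>{1..X}. \<exists>k. n = q ^ k} \<subseteq> (\<lambda>k. q ^ k) ` {..X}"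
  proof
    fix n assume "n \<in> {n\<in>{1..X}. \<exists>k. n = q ^ k}"
    then obtain k where k: "n = q ^ k" "n \<le> X" by auto
    have "k < q ^ k" using assms by (intro less_exp[THEN order_less_le_trans] power_mono) auto
    then show "n \<in> (\<lambda>k. q ^ k) ` {..X}" using k by auto
  qed
  have inj: "inj_on (\<lambda>k. q ^ k) {..X}" using assms by (auto intro!: inj_onI)
  have "(\<Sum>n\<in>{n\<in>{1..X}. \<exists>k. n = q ^ k}. 1 / real n) \<le> (\<Sum>n\<in>(\<lambda>k. q ^ k) ` {..X}. 1 / real n)"
    by (rule sum_mono2[OF _ sub]) auto
  also have "\<dots> = (\<Sum>k\<le>X. 1 / real q ^ k)" by (simp add: sum.reindex[OF inj])
  also have "\<dots> \<le> (\<Sum>k\<le>X. (1 / 2) ^ k)"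
    unfolding power_one_over using assms by (intro sum_mono frac_le power_mono) auto
  also have "\<dots> = 2 - (1 / 2) ^ X" by (induction X) (simp_all add: field_simps)
  also have "\<dots> \<le> 2" by simp
  finally show ?thesis .
qed


text \<open>The detector \<open>F n\<close> is the product of 1 + \<sigma>(p) (n/p) over
  \<open>P\<close>. If no prime fits, it vanishes at all powers of primes outside \<open>P\<close>,
  so its sum against the von Mangoldt weights is bounded. Expanded over subsets of \<open>P\<close>,
  the same sum grows like ln X, since every nonempty subset contributes a bounded amount.\<close>

lemma prime_with_prescribed_symbols:
  fixes P :: "nat set" and \<sigma> :: "nat \<Rightarrow> int"
  assumes P: "finite P" "\<And>p. p \<in> P \<Longrightarrow> prime p \<and> p > 2"
    and \<sigma>: "\<And>p. p \<in> P \<Longrightarrow> \<sigma> p = 1 \<or> \<sigma> p = -1"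
    and r: "r \<in> P" "\<sigma> r = -1"
  obtains q :: nat where "prime q" "q \<notin> P" "\<And>p. p \<in> P \<Longrightarrow> Legendre q p = \<sigma> p"
proof (rule ccontr)
  assume "\<not> thesis"
  with that have none: "\<exists>p\<in>P. Legendre q p \<noteq> \<sigma> p" if "prime q" "q \<notin> P" for q :: nat
    using that by blast
  define F where "F n = (\<Prod>p\<in>P. of_int (\<sigma> p * Legendre (int n) (int p)) + 1 :: real)" for n :: nat
  define c where "c = (2::real) ^ card P"
  have F_factor: "0 \<le> (of_int (\<sigma> p * Legendre (int n) (int p)) + 1 :: real)"
      "(of_int (\<sigma> p * Legendre (int n) (int p)) + 1 :: real) \<le> 2" if "p \<in> P" for n p
    using \<sigma>[OF that] Legendre_values[of "int n" "int p"] by auto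
  have F_nonneg: "F n \<ge> 0" for n unfolding F_def by (intro prod_nonneg F_factor)
  have F_le: "F n \<le> c" for n
  proof -
    have "F n \<le> (\<Prod>p\<in>P. 2)" unfolding F_def by (intro prod_mono conjI F_factor)
    then show ?thesis by (simp add: c_def)
  qed
  have F_zero: "F (q ^ k) = 0" if q: "prime q" "q \<notin> P" for q k :: nat
  proof -
    have pow: "Legendre (int (q ^ k)) p = Legendre q p ^ k" if "p \<in> P" for p
      using P(2)[OF that] by (induction k) (simp_all add: Legendre_one Legendre_mult)
    have pm: "Legendre q p = 1 \<or> Legendre q p = -1" if "p \<in> P" for p
    proof -
      have "\<not> p dvd q" using P(2)[OF that] q that by (metis primes_dvd_imp_eq)
      then show ?thesis by (simp add: Legendre_def cong_0_iff)
    qed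
    \<comment> \<open>For even k all symbols become 1 and a mismatch at \<open>q\<close> is no
      longer visible. The prime \<open>r\<close> with sign -1 then makes the detector vanish, so
      even powers need no separate estimate.\<close>
    obtain p where p: "p \<in> P" "\<sigma> p * Legendre q p ^ k = -1"
    proof (cases "even k")
      case True
      then have "Legendre q r ^ k = 1" using pm[OF r(1)] by auto
      then show ?thesis using that[of r] r by simp
    next
      case False
      obtain p where "p \<in> P" "Legendre q p \<noteq> \<sigma> p" using none[OF q] by blast
      then show ?thesis using that[of p] pm[of p] \<sigma>[of p] False by auto
    qed
    have "(of_int (\<sigma> p * Legendre (int (q ^ k)) p) + 1 :: real) = 0"
      by (simp only: pow[OF p(1)] p(2))
    then show ?thesis unfolding F_def using P(1) p(1) by (intro prod_zero) auto
  qed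
  have upper: "(\<Sum>n=1..X. mangoldt n * F n / real n) \<le> (\<Sum>q\<in>P. c * ln (real q) * 2)" for X
  proof -
    have "(\<Sum>n=1..X. mangoldt n * F n / real n)
        \<le> (\<Sum>n=1..X. \<Sum>q\<in>P. if \<exists>k. n = q ^ k then c * ln (real q) * (1 / real n) else 0)"
    proof (rule sum_mono)
      fix n assume "n \<in> {1..X}"
      let ?h = "\<lambda>q. if \<exists>k. n = q ^ k then c * ln (real q) * (1 / real n) else 0"
      have h: "?h q \<ge> 0" if "q \<in> P" for q using P(2)[OF that] by (simp add: c_def)
      show "mangoldt n * F n / real n \<le> sum ?h P"
      proof (cases "\<exists>q k. prime q \<and> k > 0 \<and> n = q ^ k \<and> q \<in> P")
        case True
        then obtain q k where q: "prime q" "k > 0" "n = q ^ k" "q \<in> P" by blast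
        then have "mangoldt n = ln (real q)" by simp
        moreover have "ln (real q) \<ge> 0" using P(2)[OF q(4)] by simp
        ultimately have "mangoldt n * F n / real n \<le> ln (real q) * c / real n"
          using F_le[of n] by (intro divide_right_mono) (auto intro: mult_left_mono)
        also have "\<dots> = ?h q" using q(3) by auto
        also have "\<dots> \<le> sum ?h P" by (rule member_le_sum[OF q(4)]) (use h P(1) in auto)
        finally show ?thesis .
      next
        case False
        then have "mangoldt n * F n = 0"
          using F_zero by (auto simp: mangoldt_def primepow_def)
        then have "mangoldt n * F n / real n = 0" by (simp only: div_0)
        then show ?thesis by (simp only:) (intro sum_nonneg h)
      qed
    qed
    also have "\<dots> = (\<Sum>q\<in>P. \<Sum>n=1..X. if \<exists>k. n = q ^ k then c * ln (real q) * (1 / real n) else 0)"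
      by (rule sum.swap)
    also have "\<dots> = (\<Sum>q\<in>P. c * ln (real q) * (\<Sum>n\<in>{n\<in>{1..X}. \<exists>k. n = q ^ k}. 1 / real n))"
      unfolding sum_distrib_left by (intro sum.cong[OF refl] sum.inter_filter[symmetric]) simp
    also have "\<dots> \<le> (\<Sum>q\<in>P. c * ln (real q) * 2)"
    proof (intro sum_mono mult_left_mono sum_prime_powers_le)
      fix q assume "q \<in> P"
      then show "2 \<le> q" "0 \<le> c * ln (real q)" using P(2)[of q] by (auto simp: c_def)
    qed
    finally show ?thesis .
  qed
  define \<chi> where "\<chi> Q = (\<Prod>p\<in>Q. of_int (\<sigma> p) :: real)" for Q
  have \<chi>: "\<bar>\<chi> Q\<bar> \<le> 1" if "Q \<subseteq> P" for Q
  proof -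
    have "\<bar>\<chi> Q\<bar> = (\<Prod>p\<in>Q. \<bar>of_int (\<sigma> p) :: real\<bar>)" by (simp add: \<chi>_def abs_prod)
    also have "\<dots> = 1" using that \<sigma> by (intro prod.neutral) fastforce
    finally show ?thesis by simp
  qed
  define W where "W Q X = (\<Sum>n=1..X. Legendre_product Q n * mangoldt n / real n)" for Q X
  have "\<exists>C. \<forall>X. \<bar>W Q X\<bar> \<le> C" if "Q \<in> Pow P - {{}}" for Q
  proof -
    interpret real_character "Legendre_product Q" "real (\<Prod>Q) + 1"
      by (rule Legendre_product_character) (use that P finite_subset in auto)
    show ?thesis unfolding W_def by (rule mangoldt_sum_bounded)
  qed
  then obtain C where C: "\<And>Q X. Q \<in> Pow P - {{}} \<Longrightarrow> \<bar>W Q X\<bar> \<le> C Q" by metis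
  have lower: "ln (real X) - 1 - (\<Sum>Q\<in>Pow P - {{}}. C Q) \<le> (\<Sum>n=1..X. mangoldt n * F n / real n)" if "X > 0" for X
  proof -
    have expand: "F n = (\<Sum>Q\<in>Pow P. \<chi> Q * Legendre_product Q n)" for n
      unfolding F_def prod_add[OF P(1)] by (simp add: \<chi>_def Legendre_product_def prod.distrib)
    have "(\<Sum>n=1..X. mangoldt n * F n / real n) = (\<Sum>n=1..X. \<Sum>Q\<in>Pow P. \<chi> Q * (Legendre_product Q n * mangoldt n / real n))"
      unfolding expand by (intro sum.cong refl) (simp add: sum_distrib_left sum_distrib_right sum_divide_distrib mult_ac)
    also have "\<dots> = (\<Sum>Q\<in>Pow P. \<chi> Q * W Q X)"
      unfolding W_def sum_distrib_left by (rule sum.swap)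
    also have "\<dots> = \<chi> {} * W {} X + (\<Sum>Q\<in>Pow P - {{}}. \<chi> Q * W Q X)"
      using P(1) by (intro sum.remove) auto
    also have "\<chi> {} * W {} X = (\<Sum>n=1..X. mangoldt n / real n)"
      by (simp add: \<chi>_def W_def Legendre_product_def)
    finally have eq: "(\<Sum>n=1..X. mangoldt n * F n / real n)
        = (\<Sum>n=1..X. mangoldt n / real n) + (\<Sum>Q\<in>Pow P - {{}}. \<chi> Q * W Q X)" .
    have "(\<Sum>Q\<in>Pow P - {{}}. - C Q) \<le> (\<Sum>Q\<in>Pow P - {{}}. \<chi> Q * W Q X)"
    proof (rule sum_mono)
      fix Q assume Q: "Q \<in> Pow P - {{}}"
      then have "\<bar>\<chi> Q\<bar> * \<bar>W Q X\<bar> \<le> 1 * C Q" by (intro mult_mono \<chi> C) auto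
      then show "- C Q \<le> \<chi> Q * W Q X" by (simp add: abs_mult[symmetric] abs_le_iff)
    qed
    then show ?thesis unfolding eq using sum_mangoldt_div_ge[OF that] by (simp add: sum_negf)
  qed
  define D where "D = 1 + (\<Sum>Q\<in>Pow P - {{}}. C Q) + (\<Sum>q\<in>P. c * ln (real q) * 2)"
  obtain X :: nat where X: "exp D < real X" using reals_Archimedean2 by blast
  then have "X > 0" using exp_gt_zero[of D] by (cases X) auto
  then have "ln (real X) \<le> D" using lower[of X] upper[of X] by (simp add: D_def)
  then have "exp (ln (real X)) \<le> exp D" by simp
  then show False using X \<open>X > 0\<close> by simp
qed

section \<open>Ternary quadratic forms\<close>

lemma nearest_int:
  fixes a t :: int
  assumes "t > 0"
  obtains k where "\<bar>a - k * t\<bar> * 2 \<le> t"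
proof
  define k where "k = (2 * a + t) div (2 * t)"
  have "2 * t * k + (2 * a + t) mod (2 * t) = 2 * a + t" by (simp add: k_def)
  moreover have "0 \<le> (2 * a + t) mod (2 * t)" "(2 * a + t) mod (2 * t) < 2 * t" using assms by simp_all
  ultimately have "2 * (a - k * t) \<le> t" "- t \<le> 2 * (a - k * t)" by (simp_all add: algebra_simps)
  then show "\<bar>a - k * t\<bar> * 2 \<le> t" by linarith
qed

section \<open>Davenport-Cassels descent\<close>

definition ternary :: "int \<Rightarrow> int \<Rightarrow> int \<Rightarrow> int"
  where "ternary x y z = x\<^sup>2 + x * y + y\<^sup>2 + z\<^sup>2"

lemma four_ternary: "4 * ternary x y z = (2 * x + y)\<^sup>2 + 3 * y\<^sup>2 + 4 * z\<^sup>2"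
  by (simp add: ternary_def power2_eq_square algebra_simps)

lemma ternary_nonneg: "ternary x y z \<ge> 0"
proof -
  have "4 * ternary x y z \<ge> 0" unfolding four_ternary by simp
  then show ?thesis by simp
qed

lemma ternary_eq_0: "ternary x y z = 0 \<Longrightarrow> x = 0 \<and> y = 0 \<and> z = 0"
proof -
  assume "ternary x y z = 0"
  then have "(2 * x + y)\<^sup>2 + 3 * y\<^sup>2 + 4 * z\<^sup>2 = 0" using four_ternary[of x y z] by simp
  moreover have "(2 * x + y)\<^sup>2 \<ge> 0" "y\<^sup>2 \<ge> 0" "z\<^sup>2 \<ge> 0" by simp_all
  ultimately have "(2 * x + y)\<^sup>2 = 0" "y\<^sup>2 = 0" "z\<^sup>2 = 0" by linarith+
  then show ?thesis by simp
qed

text \<open>The line through the rational point (x, y, z) / t and a close lattice point (a, b, c)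
  meets the quadric \<open>ternary = N\<close> again. The new denominator is t times the value of
  the form at the difference of the two points, and that value is at most 11/16.\<close>

lemma ternary_descent:
  fixes t :: nat
  assumes "t > 0" "N * (int t)\<^sup>2 = ternary x y z"
  shows "\<exists>x y z. N = ternary x y z"
  using assms
proof (induction t arbitrary: x y z rule: less_induct)
  case (less t)
  define T where "T = int t"
  have T: "T > 0" using less by (simp add: T_def)
  obtain c where c: "\<bar>z - c * T\<bar> * 2 \<le> T" using nearest_int[OF T] .
  obtain b where b: "\<bar>y - b * T\<bar> * 2 \<le> T" using nearest_int[OF T] .
  \<comment> \<open>\<open>a\<close> is chosen last, against the already reduced y, because the
    completed square in \<open>four_ternary\<close> measures x through 2 x + y.\<close>
  obtain a where a: "\<bar>(2 * x + (y - b * T)) - a * (2 * T)\<bar> * 2 \<le> 2 * T"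
    using nearest_int[of "2 * T" "2 * x + (y - b * T)"] T by auto
  define f where "f = ternary (x - a * T) (y - b * T) (z - c * T)"
  define B where "B = 2 * x * a + x * b + y * a + 2 * y * b + 2 * z * c"
  define g where "g = ternary a b c"
  define s where "s = N * T - B + T * g"
  have NT: "N * T\<^sup>2 = ternary x y z" using less by (simp add: T_def)
  have "f = ternary x y z - T * B + T\<^sup>2 * g"
    by (simp add: f_def B_def g_def ternary_def power2_eq_square algebra_simps)
  also have "\<dots> = T * s" unfolding NT[symmetric] s_def by (simp add: power2_eq_square algebra_simps)
  finally have fs: "f = T * s" .
  have dbl: "4 * u\<^sup>2 \<le> T\<^sup>2" if "\<bar>u\<bar> * 2 \<le> T" for u
  proof -
    have "(2 * u)\<^sup>2 \<le> T\<^sup>2" by (rule abs_le_square_iff[THEN iffD1]) (use that in linarith)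
    then show ?thesis unfolding power_mult_distrib by simp
  qed
  have "4 * f = (2 * (x - a * T) + (y - b * T))\<^sup>2 + 3 * (y - b * T)\<^sup>2 + 4 * (z - c * T)\<^sup>2"
    unfolding f_def by (rule four_ternary)
  moreover have "(2 * (x - a * T) + (y - b * T))\<^sup>2 \<le> T\<^sup>2"
    by (rule abs_le_square_iff[THEN iffD1]) (use a T in \<open>simp add: algebra_simps\<close>)
  moreover note dbl[OF b] dbl[OF c]
  moreover have "T\<^sup>2 > 0" using T by simp
  ultimately have "f < T\<^sup>2" by linarith
  then have "s < T" using fs T by (simp add: power2_eq_square)
  have "T * s \<ge> 0" unfolding fs[symmetric] f_def by (rule ternary_nonneg)
  then have "s \<ge> 0" using T by (simp add: zero_le_mult_iff)
  show ?case
  proof (cases "s = 0")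
    case True
    then have "ternary (x - a * T) (y - b * T) (z - c * T) = 0" using fs by (simp add: f_def)
    from ternary_eq_0[OF this] have "x = a * T" "y = b * T" "z = c * T" by simp_all
    then have "N * T\<^sup>2 = g * T\<^sup>2" using NT by (simp add: g_def ternary_def power2_eq_square algebra_simps)
    then show ?thesis using T by (auto simp: g_def)
  next
    case False
    \<comment> \<open>Weights of the second intersection point: (e (x, y, z) + h (a, b, c)) / s. It
      lies on the line since e T + h = s.\<close>
    define e where "e = g - N"
    define h where "h = 2 * N * T - B"
    have "ternary (e * x + h * a) (e * y + h * b) (e * z + h * c) = e\<^sup>2 * ternary x y z + e * h * B + h\<^sup>2 * g"
      by (simp add: B_def g_def ternary_def power2_eq_square algebra_simps)
    also have "\<dots> = e\<^sup>2 * (N * T\<^sup>2) + e * h * (2 * N * T - h) + h\<^sup>2 * (e + N)"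
      unfolding NT by (simp add: h_def e_def)
    also have "\<dots> = N * (e * T + h)\<^sup>2" by (simp add: power2_eq_square algebra_simps)
    also have "e * T + h = s" by (simp add: e_def h_def s_def algebra_simps)
    finally have "N * (int (nat s))\<^sup>2 = ternary (e * x + h * a) (e * y + h * b) (e * z + h * c)"
      using \<open>s \<ge> 0\<close> by simp
    moreover have "nat s < t" "nat s > 0" using \<open>s < T\<close> \<open>s \<ge> 0\<close> False by (auto simp: T_def)
    ultimately show ?thesis using less.IH by blast
  qed
qed

text \<open>The even one among \<open>x\<close>, \<open>y\<close>, \<open>x + y\<close> completes the square over the integers.\<close>
lemma ternary_to_diagonal: "\<exists>a b c. ternary x y z = a\<^sup>2 + b\<^sup>2 + 3 * c\<^sup>2"
proof -
  have *: "\<exists>a c. u\<^sup>2 + u * v + v\<^sup>2 = a\<^sup>2 + 3 * c\<^sup>2" if "even v" for u v :: int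
  proof -
    from that obtain w where "v = 2 * w" ..
    then have "u\<^sup>2 + u * v + v\<^sup>2 = (u + w)\<^sup>2 + 3 * w\<^sup>2" by (simp add: power2_eq_square algebra_simps)
    then show ?thesis by blast
  qed
  have "\<exists>a c. x\<^sup>2 + x * y + y\<^sup>2 = a\<^sup>2 + 3 * c\<^sup>2"
  proof -
    consider "even y" | "even x" | "even (- (x + y))" by auto
    then show ?thesis
    proof cases
      case 1 then show ?thesis by (rule *)
    next
      case 2 show ?thesis using *[OF 2, of y] by (simp add: algebra_simps)
    next
      case 3
      have "x\<^sup>2 + x * (- (x + y)) + (- (x + y))\<^sup>2 = x\<^sup>2 + x * y + y\<^sup>2" by (simp add: power2_eq_square algebra_simps)
      then show ?thesis using *[OF 3, of x] by metis
    qed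
  qed
  then obtain a c where "x\<^sup>2 + x * y + y\<^sup>2 = a\<^sup>2 + 3 * c\<^sup>2" by blast
  then have "ternary x y z = a\<^sup>2 + z\<^sup>2 + 3 * c\<^sup>2" by (simp add: ternary_def)
  then show ?thesis by blast
qed

section \<open>Legendre's equation by the pigeonhole principle\<close>

lemma square_neq_mult_prime:
  fixes m q x :: nat
  assumes "prime q" "coprime m q"
  shows "x\<^sup>2 \<noteq> m * q"
proof
  assume eq: "x\<^sup>2 = m * q"
  then have "q dvd x" using assms(1) by (metis dvd_triv_right prime_dvd_power)
  then obtain y where "x = q * y" ..
  then have "q * (q * y\<^sup>2) = q * m" using eq by (simp add: power2_eq_square algebra_simps)
  then have "q dvd m" using assms(1) by (auto simp: prime_gt_0_nat)
  then show False using assms by (metis coprime_absorb_left coprime_commute not_prime_unit)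
qed

text \<open>Pigeonhole: the congruences \<open>x \<equiv> l s (mod m)\<close>, \<open>x \<equiv> k w (mod q)\<close> have a small solution, where the form
  \<open>x\<^sup>2 + q s\<^sup>2 - m w\<^sup>2\<close> is \<open>0\<close> or \<open>m q\<close>. The second case is reduced to the first by the composition
  \<open>(x\<^sup>2 + q s\<^sup>2) (w\<^sup>2 + q) = (x w + q s)\<^sup>2 + q (x - s w)\<^sup>2\<close>.\<close>
lemma Legendre_equation:
  fixes m q :: nat and l k :: int
  assumes q: "prime q" and m: "m > 0" and cop: "coprime m q"
    and l: "[l\<^sup>2 = - int q] (mod int m)" and k: "[k\<^sup>2 = int m] (mod int q)"
  shows "\<exists>x s w::int. int m * w\<^sup>2 = x\<^sup>2 + int q * s\<^sup>2 \<and> w \<noteq> 0"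
proof -
  have q0: "q > 0" using q prime_gt_0_nat by blast
  define X where "X = floor_sqrt (m * q)"
  have X: "X\<^sup>2 \<le> m * q" "m * q < (X + 1)\<^sup>2"
    using Suc_floor_sqrt_power2_gt[of "m * q"] by (simp_all add: X_def)
  define S where "S = floor_sqrt m"
  have S: "S\<^sup>2 \<le> m" "m < (S + 1)\<^sup>2"
    using Suc_floor_sqrt_power2_gt[of "m"] by (simp_all add: S_def)
  define W where "W = floor_sqrt q"
  have W: "W\<^sup>2 \<le> q" "q < (W + 1)\<^sup>2"
    using Suc_floor_sqrt_power2_gt[of "q"] by (simp_all add: W_def)
  have "X\<^sup>2 \<noteq> m * q" by (rule square_neq_mult_prime[OF q cop])
  have "W\<^sup>2 \<noteq> 1 * q" by (rule square_neq_mult_prime[OF q]) simp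
  \<comment> \<open>The sides exceed the square roots of m q, m and q, so the box holds more than m
    q points, the number of residue pairs.\<close>
  define A where "A = {0..int X} \<times> {0..int S} \<times> {0..int W}"
  define h where "h = (\<lambda>(x, s, w). ((x - l * s) mod int m, (x - k * w) mod int q))"
  have "h ` A \<subseteq> {0..<int m} \<times> {0..<int q}" using m q0 by (auto simp: h_def)
  then have "card (h ` A) \<le> card ({0..<int m} \<times> {0..<int q})" by (intro card_mono) auto
  then have "card (h ` A) \<le> m * q" by simp
  moreover have "card A > m * q"
  proof -
    have "(m * q)\<^sup>2 = (m * q) * m * q" by (simp add: power2_eq_square)
    also have "\<dots> < (X + 1)\<^sup>2 * (S + 1)\<^sup>2 * (W + 1)\<^sup>2"
      using X S W m q0 by (intro mult_strict_mono) auto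
    also have "\<dots> = ((X + 1) * (S + 1) * (W + 1))\<^sup>2" by (simp only: power_mult_distrib)
    finally have "m * q < (X + 1) * (S + 1) * (W + 1)" by (rule power_less_imp_less_base) simp
    moreover have "card A = (X + 1) * (S + 1) * (W + 1)"
      by (simp only: A_def card_cartesian_product card_atLeastAtMost_int) (simp add: nat_add_distrib algebra_simps)
    ultimately show ?thesis by simp
  qed
  ultimately have "\<not> inj_on h A" by (intro pigeonhole) simp
  then obtain u v where uv: "u \<in> A" "v \<in> A" "u \<noteq> v" "h u = h v" unfolding inj_on_def by blast
  obtain x1 s1 w1 x2 s2 w2 where u: "u = (x1, s1, w1)" and v: "v = (x2, s2, w2)" by (cases u; cases v) blast
  define x s w where "x = x1 - x2" and "s = s1 - s2" and "w = w1 - w2"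
  have nz: "\<not> (x = 0 \<and> s = 0 \<and> w = 0)" using uv(3) by (simp add: u v x_def s_def w_def)
  have "\<bar>x\<bar> \<le> int X" "\<bar>s\<bar> \<le> int S" "\<bar>w\<bar> \<le> int W" using uv(1,2) by (auto simp: A_def u v x_def s_def w_def)
  then have "x\<^sup>2 \<le> (int X)\<^sup>2" "s\<^sup>2 \<le> (int S)\<^sup>2" "w\<^sup>2 \<le> (int W)\<^sup>2"
    unfolding abs_le_square_iff[symmetric] by simp_all
  moreover have "(int X)\<^sup>2 < int m * int q"
    using X(1) \<open>X\<^sup>2 \<noteq> m * q\<close> unfolding of_nat_power[symmetric] of_nat_mult[symmetric] of_nat_less_iff by linarith
  moreover have "(int S)\<^sup>2 \<le> int m"
    using S(1) unfolding of_nat_power[symmetric] of_nat_le_iff .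
  moreover have "(int W)\<^sup>2 < int q"
    using W(1) \<open>W\<^sup>2 \<noteq> 1 * q\<close> unfolding of_nat_power[symmetric] of_nat_less_iff by linarith
  ultimately have x2: "x\<^sup>2 < int m * int q" and s2: "s\<^sup>2 \<le> int m" and w2: "w\<^sup>2 < int q" by linarith+
  have "int m dvd (x1 - l * s1) - (x2 - l * s2)" "int q dvd (x1 - k * w1) - (x2 - k * w2)"
    using uv(4) by (simp_all add: h_def u v mod_eq_dvd_iff)
  then have dm: "int m dvd x - l * s" and dq: "int q dvd x - k * w"
    by (simp_all add: x_def s_def w_def algebra_simps)
  define E where "E = x\<^sup>2 + int q * s\<^sup>2 - int m * w\<^sup>2"
  have "int m dvd E"
  proof -
    have "E = (x - l * s) * (x + l * s) + (l\<^sup>2 - (- int q)) * s\<^sup>2 - int m * w\<^sup>2"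
      by (simp add: E_def power2_eq_square algebra_simps)
    then show ?thesis using dm l by (simp add: cong_iff_dvd_diff)
  qed
  moreover have "int q dvd E"
  proof -
    have "E = (x - k * w) * (x + k * w) + (k\<^sup>2 - int m) * w\<^sup>2 + int q * s\<^sup>2"
      by (simp add: E_def power2_eq_square algebra_simps)
    then show ?thesis using dq k by (simp add: cong_iff_dvd_diff)
  qed
  moreover have "coprime (int m) (int q)" using cop by simp
  ultimately have "int m * int q dvd E" by (rule divides_mult)
  then obtain j where j: "E = int m * int q * j" ..
  \<comment> \<open>Since x^2 < m q and w^2 < q hold strictly, \<open>E\<close> lies strictly
    between - m q and 2 m q. This is where m q and q not being squares enters.\<close>
  have mq: "int m * int q > 0" using m q0 by simp
  have "E < int m * int q * 2"
  proof -
    have "int q * s\<^sup>2 \<le> int q * int m" using s2 by (intro mult_left_mono) auto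
    moreover have "0 \<le> int m * w\<^sup>2" by simp
    moreover have "int m * int q * 2 = int m * int q + int q * int m" by simp
    ultimately show ?thesis using x2 unfolding E_def by linarith
  qed
  then have "j < 2" unfolding j mult_less_cancel_left_pos[OF mq] .
  have "int m * int q * (- 1) < E"
  proof -
    have "int m * w\<^sup>2 < int m * int q" using w2 m by (intro mult_strict_left_mono) auto
    moreover have "0 \<le> x\<^sup>2" "0 \<le> int q * s\<^sup>2" by simp_all
    ultimately show ?thesis unfolding E_def by linarith
  qed
  then have "j > - 1" unfolding j mult_less_cancel_left_pos[OF mq] .
  with \<open>j < 2\<close> consider "j = 0" | "j = 1" by linarith
  then show ?thesis
  proof cases
    case 1
    then have eq: "int m * w\<^sup>2 = x\<^sup>2 + int q * s\<^sup>2" using j by (simp add: E_def)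
    have "w \<noteq> 0"
    proof
      assume "w = 0"
      then have "x\<^sup>2 + int q * s\<^sup>2 = 0" using eq by simp
      moreover have "x\<^sup>2 \<ge> 0" "int q * s\<^sup>2 \<ge> 0" by simp_all
      ultimately have "x\<^sup>2 = 0" "int q * s\<^sup>2 = 0" by linarith+
      then show False using nz \<open>w = 0\<close> q0 by simp
    qed
    then show ?thesis using eq by blast
  next
    case 2
    then have eq: "x\<^sup>2 + int q * s\<^sup>2 = int m * (w\<^sup>2 + int q)" using j by (simp add: E_def algebra_simps)
    have "int m * (w\<^sup>2 + int q)\<^sup>2 = (x\<^sup>2 + int q * s\<^sup>2) * (w\<^sup>2 + int q)" unfolding eq by (simp add: power2_eq_square)
    also have "\<dots> = (x * w + int q * s)\<^sup>2 + int q * (x - s * w)\<^sup>2"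
      by (simp add: power2_eq_square algebra_simps)
    finally have "int m * (w\<^sup>2 + int q)\<^sup>2 = (x * w + int q * s)\<^sup>2 + int q * (x - s * w)\<^sup>2" .
    moreover have "w\<^sup>2 + int q \<noteq> 0" using q0 zero_le_power2[of w] by linarith
    ultimately show ?thesis by blast
  qed
qed

section \<open>Numbers represented by a diagonal form\<close>

lemma quadratic_residue_mod_prod:
  fixes P :: "nat set" and a :: int
  assumes "finite P" "\<And>p. p \<in> P \<Longrightarrow> prime p" "\<And>p. p \<in> P \<Longrightarrow> \<exists>x. [x\<^sup>2 = a] (mod int p)"
  shows "\<exists>x. [x\<^sup>2 = a] (mod int (\<Prod>P))"
  using assms
proof (induction P rule: finite_induct)
  case (insert p P)
  obtain x y where x: "[x\<^sup>2 = a] (mod int p)" and y: "[y\<^sup>2 = a] (mod int (\<Prod>P))"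
    using insert by (metis insert_iff)
  have cop: "coprime p (\<Prod>P)"
    using insert by (intro prod_coprime_right) (metis insert_iff primes_coprime)
  then have "coprime (int p) (int (\<Prod>P))" by (simp only: coprime_int_iff)
  from binary_chinese_remainder_int[OF this, of x y]
  obtain z where z: "[z = x] (mod int p)" "[z = y] (mod int (\<Prod>P))" by blast
  have "[z\<^sup>2 = a] (mod int p)" "[z\<^sup>2 = a] (mod int (\<Prod>P))"
    using z x y by (meson cong_pow cong_trans)+
  then have "[z\<^sup>2 = a] (mod (int p * int (\<Prod>P)))"
    using \<open>coprime (int p) (int (\<Prod>P))\<close> by (rule coprime_cong_mult)
  moreover have "int p * int (\<Prod>P) = int (\<Prod>(insert p P))" using insert.hyps by simp
  ultimately show ?case by metis
qed simp

lemma Legendre_eq_1D: "Legendre a p = 1 \<Longrightarrow> \<exists>x. [x\<^sup>2 = a] (mod p)"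
  by (auto simp: Legendre_def QuadRes_def split: if_splits)

lemma Legendre_minus_one:
  fixes p :: nat
  assumes "prime p" "p > 2"
  shows "Legendre (-1) p = (-1) ^ ((p - 1) div 2)"
proof -
  have "[Legendre (-1) p = (-1) ^ ((p - 1) div 2)] (mod int p)" by (intro euler_criterion assms)
  then have d: "int p dvd Legendre (-1) p - (-1) ^ ((p - 1) div 2)" by (simp add: cong_iff_dvd_diff)
  have "(-1::int) ^ ((p - 1) div 2) = 1 \<or> (-1::int) ^ ((p - 1) div 2) = -1"
    by (cases "even ((p - 1) div 2)") simp_all
  then have "\<bar>Legendre (-1) p - (-1) ^ ((p - 1) div 2)\<bar> < int p"
    using Legendre_values[of "-1" p] assms(2) by (elim disjE) simp_all
  then show ?thesis using dvd_imp_le_int[OF _ d] by fastforce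
qed

text \<open>The sign attached to an odd p is the representative of p modulo 4 in {1, -1}.\<close>

lemma prod_primes_mod_4:
  assumes "finite P" "\<And>p. p \<in> P \<Longrightarrow> odd p"
  shows "[(\<Prod>p\<in>P. (-1::int) ^ ((p - 1) div 2)) = int (\<Prod>P)] (mod 4)"
proof -
  have "[(-1::int) ^ ((p - 1) div 2) = int p] (mod 4)" if "odd p" for p :: nat
  proof -
    obtain k where k: "p = 2 * k + 1" using \<open>odd p\<close> by (elim oddE)
    show ?thesis
    proof (cases "even k")
      case True
      then obtain j where "k = 2 * j" by (elim evenE)
      then show ?thesis by (simp add: k cong_iff_dvd_diff)
    next
      case False
      then obtain j where "k = 2 * j + 1" by (elim oddE)
      then show ?thesis by (simp add: k cong_iff_dvd_diff)
    qed
  qed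
  then have "[(\<Prod>p\<in>P. (-1::int) ^ ((p - 1) div 2)) = (\<Prod>p\<in>P. int p)] (mod 4)"
    by (intro cong_prod) (use assms in auto)
  then show ?thesis by simp
qed

text \<open>Multiplicativity in the upper argument, reciprocity for each prime factor of \<open>m\<close>, and \<open>m \<equiv> 1 (mod 4)\<close>
  show that \<open>m\<close> is a square modulo \<open>q\<close>, whatever the residue of \<open>q\<close> modulo \<open>4\<close>.\<close>
lemma Legendre_prod_reciprocal:
  fixes P :: "nat set" and q :: nat
  assumes P: "finite P" "\<And>p. p \<in> P \<Longrightarrow> prime p \<and> p > 2" and q: "prime q" "q > 2" "q \<notin> P"
    and sym: "\<And>p. p \<in> P \<Longrightarrow> Legendre q p = Legendre (-1) p"
    and m: "[\<Prod>P = 1] (mod 4)"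
  shows "Legendre (int (\<Prod>P)) q = 1"
proof -
  \<comment> \<open>By assumption (q/p) is the sign (-1)^((p-1)/2). Reciprocity multiplies it by its
    power with exponent (q-1)/2, and the resulting exponent is the same for every p.\<close>
  have rec: "Legendre p q = ((-1) ^ ((p - 1) div 2)) ^ ((q - 1) div 2 + 1)" if "p \<in> P" for p
  proof -
    have pm: "Legendre q p = (-1) ^ ((p - 1) div 2)"
      using sym[OF that] Legendre_minus_one P(2)[OF that] by simp
    have "Legendre p q * Legendre q p = (-1) ^ ((p - 1) div 2 * ((q - 1) div 2))"
      using P(2)[OF that] q that by (intro Quadratic_Reciprocity) auto
    then have "Legendre p q * (Legendre q p * Legendre q p) = (-1) ^ ((p - 1) div 2 * ((q - 1) div 2)) * Legendre q p"
      by (simp only: mult.assoc[symmetric])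
    moreover have "Legendre q p * Legendre q p = 1"
      unfolding pm by (simp flip: power_mult_distrib)
    ultimately show ?thesis unfolding pm by (simp add: power_mult power_add)
  qed
  have mult: "Legendre (int (\<Prod>Q)) q = (\<Prod>p\<in>Q. Legendre p q)" if "finite Q" for Q :: "nat set"
    using that
  proof (induction Q rule: finite_induct)
    case empty
    show ?case using q(2) by (simp add: Legendre_one)
  next
    case (insert p Q)
    then show ?case using Legendre_mult[OF q(1,2)] by simp
  qed
  define e where "e = (\<Prod>p\<in>P. (-1::int) ^ ((p - 1) div 2))"
  have "[e = int (\<Prod>P)] (mod 4)" unfolding e_def
    using P by (intro prod_primes_mod_4) (auto dest: prime_odd_nat)
  moreover have "[int (\<Prod>P) = 1] (mod 4)" using m by (metis cong_int_iff of_nat_1 of_nat_numeral)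
  ultimately have "[e = 1] (mod 4)" by (rule cong_trans)
  moreover have "e = 1 \<or> e = -1"
  proof -
    have "\<bar>e\<bar> = (\<Prod>p\<in>P. \<bar>(-1::int) ^ ((p - 1) div 2)\<bar>)" by (simp only: e_def abs_prod)
    then have "\<bar>e\<bar> = 1" by (simp add: power_abs)
    then show ?thesis by linarith
  qed
  ultimately have "e = 1" by (auto simp: cong_def)
  have "Legendre (int (\<Prod>P)) q = e ^ ((q - 1) div 2 + 1)"
    unfolding mult[OF P(1)] e_def prod_power_distrib by (intro prod.cong refl rec)
  then show ?thesis using \<open>e = 1\<close> by simp
qed

lemma squarefree_prod_primes:
  fixes m :: nat
  assumes "squarefree m"
  shows "\<Prod>{p. prime p \<and> p dvd m} = m"
proof -
  have "m > 0" using assms by (cases m) auto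
  have "m = (\<Prod>p\<in>prime_factors m. p ^ multiplicity p m)"
    using \<open>m > 0\<close> by (simp add: prime_factorization_nat)
  also have "\<dots> = (\<Prod>p\<in>prime_factors m. p)"
  proof (intro prod.cong refl)
    fix p assume p: "p \<in> prime_factors m"
    then have "multiplicity p m \<le> 1" using assms \<open>m > 0\<close>
      by (auto simp: squarefree_factorial_semiring'' in_prime_factors_iff)
    moreover have "multiplicity p m > 0" using p by (simp add: prime_factors_multiplicity)
    ultimately have "multiplicity p m = 1" by linarith
    then show "p ^ multiplicity p m = p" by simp
  qed
  also have "prime_factors m = {p. prime p \<and> p dvd m}"
    using \<open>m > 0\<close> by (auto simp: in_prime_factors_iff)
  finally show ?thesis by simp
qed

text \<open>\<open>N mod 4 = 1\<close> passes to the squarefree part because \<open>k\<close> is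
  odd. The prime 3 must not divide N: as a factor of m it would demand (q/3) = (-1/3) = -1, against
  the value 1 that q u^2 = y^2 + 3 z^2 requires.\<close>

lemma diagonal_representation:
  fixes N :: nat
  assumes N4: "N mod 4 = 1" and N3: "\<not> 3 dvd N"
  shows "\<exists>x y z::int. int N = x\<^sup>2 + y\<^sup>2 + 3 * z\<^sup>2"
proof -
  define m k where "m = squarefree_part N" and "k = square_part N"
  have N: "N = m * k\<^sup>2" unfolding m_def k_def by (rule squarefree_decompose)
  have sqf: "squarefree m" unfolding m_def by (rule squarefree_squarefree_part)
  have "odd N" using N4 by presburger
  then have "odd k" "odd m" using N by auto
  have "m > 0" using \<open>odd m\<close> by (cases m) auto
  have "[k\<^sup>2 = 1] (mod 4)"
  proof -
    obtain j where "k = 2 * j + 1" using \<open>odd k\<close> by (elim oddE)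
    then have "k\<^sup>2 = 1 + (j\<^sup>2 + j) * 4" by (simp add: power2_eq_square algebra_simps)
    then show ?thesis unfolding cong_def by (metis mod_mult_self1)
  qed
  then have "[m * k\<^sup>2 = m * 1] (mod 4)" by (intro cong_mult cong_refl)
  then have m4: "[m = 1] (mod 4)" using N4 by (simp add: N cong_def)
  have m3: "\<not> 3 dvd m" using N3 N by auto
  define P where "P = {p. prime p \<and> p dvd m}"
  have finP: "finite P" unfolding P_def using \<open>m > 0\<close> by (intro finite_subset[OF _ finite_divisors_nat[of m]]) auto
  have prodP: "\<Prod>P = m" unfolding P_def using sqf by (rule squarefree_prod_primes)
  have P2: "prime p \<and> p > 2" if "p \<in> P" for p
  proof -
    have "p \<noteq> 2" using that \<open>odd m\<close> by (auto simp: P_def)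
    then show ?thesis using that prime_ge_2_nat[of p] by (auto simp: P_def)
  qed
  \<comment> \<open>A dummy prime beyond 3 and all divisors of m. It only carries the symbol -1 that
    \<open>prime_with_prescribed_symbols\<close> asks for.\<close>
  obtain r where r: "prime r" "r > m + 3" using bigger_prime by blast
  have rP: "r \<notin> P" "r \<noteq> 3" using r \<open>m > 0\<close> by (auto simp: P_def dest: dvd_imp_le)
  have "3 \<notin> P" using m3 by (simp add: P_def)
  define \<sigma> where "\<sigma> p = (if p = r then -1 else if p = 3 then 1 else Legendre (-1) (int p))" for p :: nat
  obtain q where q: "prime q" "q \<notin> insert r (insert 3 P)"
    and sym: "\<And>p. p \<in> insert r (insert 3 P) \<Longrightarrow> Legendre q p = \<sigma> p"
  proof (rule prime_with_prescribed_symbols[of "insert r (insert 3 P)" \<sigma> r])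
    show "finite (insert r (insert 3 P))" using finP by simp
    show "prime p \<and> p > 2" if "p \<in> insert r (insert 3 P)" for p using that P2 r by auto
    show "\<sigma> p = 1 \<or> \<sigma> p = -1" if "p \<in> insert r (insert 3 P)" for p
    proof (cases "p \<in> P")
      case True
      then have "Legendre (-1) p = (-1) ^ ((p - 1) div 2)" using Legendre_minus_one P2 by blast
      then show ?thesis by (cases "even ((p - 1) div 2)") (simp_all add: \<sigma>_def)
    qed (use that in \<open>auto simp: \<sigma>_def\<close>)
  qed (auto simp: \<sigma>_def)
  have "Legendre q 3 = 1" using sym[of 3] rP by (simp add: \<sigma>_def)
  have "q \<noteq> 2"
  proof
    assume "q = 2"
    obtain x where "[x\<^sup>2 = 2] (mod (3::int))" using Legendre_eq_1D \<open>Legendre q 3 = 1\<close> \<open>q = 2\<close> by fastforce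
    moreover have "x mod 3 = 0 \<or> x mod 3 = 1 \<or> x mod 3 = 2" by presburger
    moreover have "x\<^sup>2 mod 3 = (x mod 3)\<^sup>2 mod 3" by (simp add: power_mod)
    ultimately show False by (auto simp: cong_def)
  qed
  then have q2: "q > 2" using prime_ge_2_nat[OF q(1)] by simp
  have symP: "Legendre q p = Legendre (-1) p" if "p \<in> P" for p
    using sym[of p] that rP \<open>3 \<notin> P\<close> by (auto simp: \<sigma>_def)
  have "coprime m q"
  proof -
    have "\<not> q dvd m" using q by (simp add: P_def)
    then show ?thesis using q(1) by (metis coprime_commute prime_imp_coprime)
  qed
  have "Legendre m q = 1"
    using Legendre_prod_reciprocal[OF finP P2 q(1) q2 _ symP] q(2) m4 by (simp add: prodP)
  then obtain b where b: "[b\<^sup>2 = int m] (mod int q)" using Legendre_eq_1D by blast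
  have "\<exists>x. [x\<^sup>2 = - int q] (mod int p)" if "p \<in> P" for p
  proof -
    have "Legendre (- 1) p * Legendre (- 1) p = 1"
      using Legendre_minus_one P2[OF that] by (simp flip: power_mult_distrib)
    moreover have "Legendre (- 1 * int q) p = Legendre (-1) p * Legendre q p"
      using P2[OF that] by (intro Legendre_mult) auto
    ultimately have "Legendre (- int q) p = 1" using symP[OF that] by simp
    then show ?thesis by (rule Legendre_eq_1D)
  qed
  with quadratic_residue_mod_prod[OF finP, of "- int q"]
  obtain a where a: "[a\<^sup>2 = - int q] (mod int m)" using P2 prodP by metis
  obtain x s w where eq1: "int m * w\<^sup>2 = x\<^sup>2 + int q * s\<^sup>2" "w \<noteq> 0"
    using Legendre_equation[OF q(1) \<open>m > 0\<close> \<open>coprime m q\<close> a b] by blast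
  \<comment> \<open>(-3/q) = (q/3) whatever q is modulo 4: the sign from reciprocity cancels
    (-1/q).\<close>
  have "\<exists>l. [l\<^sup>2 = - 3] (mod int q)"
  proof -
    have "Legendre (int 3) q * Legendre q (int 3) = (-1) ^ ((3 - 1) div 2 * ((q - 1) div 2))"
      using q q2 by (intro Quadratic_Reciprocity) auto
    then have "Legendre 3 q = Legendre (-1) q"
      using \<open>Legendre q 3 = 1\<close> Legendre_minus_one[OF q(1) q2] by simp
    then have "Legendre (-1 * 3) q = Legendre (-1) q * Legendre (-1) q"
      using Legendre_mult[OF q(1) q2, of "-1" 3] by simp
    also have "\<dots> = 1" using Legendre_minus_one[OF q(1) q2] by (simp flip: power_mult_distrib)
    finally have "Legendre (-3) q = 1" by simp
    then show ?thesis by (rule Legendre_eq_1D)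
  qed
  then obtain l where l: "[l\<^sup>2 = - int 3] (mod int q)" by auto
  obtain j where j: "[j\<^sup>2 = int q] (mod int 3)" using Legendre_eq_1D[OF \<open>Legendre q 3 = 1\<close>] by auto
  have "coprime q 3" using q by (simp add: primes_coprime)
  obtain y z u where eq2: "int q * u\<^sup>2 = y\<^sup>2 + 3 * z\<^sup>2" "u \<noteq> 0"
    using Legendre_equation[OF _ _ \<open>coprime q 3\<close> l j] q(1) by (auto simp: prime_gt_0_nat)
  have eq3: "int m * (w * u)\<^sup>2 = (x * u)\<^sup>2 + (s * y)\<^sup>2 + 3 * (s * z)\<^sup>2"
  proof -
    have "int m * (w * u)\<^sup>2 = (x\<^sup>2 + int q * s\<^sup>2) * u\<^sup>2" by (simp add: eq1(1)[symmetric] power_mult_distrib)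
    also have "\<dots> = (x * u)\<^sup>2 + s\<^sup>2 * (int q * u\<^sup>2)" by (simp add: power_mult_distrib algebra_simps)
    also have "\<dots> = (x * u)\<^sup>2 + (s * y)\<^sup>2 + 3 * (s * z)\<^sup>2" unfolding eq2(1) by (simp add: power_mult_distrib algebra_simps)
    finally show ?thesis .
  qed
  have "int N * (w * u)\<^sup>2 = (int k)\<^sup>2 * (int m * (w * u)\<^sup>2)" by (simp add: N)
  also have "\<dots> = (k * (x * u))\<^sup>2 + (k * (s * y))\<^sup>2 + 3 * (k * (s * z))\<^sup>2"
    unfolding eq3 by (simp add: power_mult_distrib algebra_simps)
  \<comment> \<open>With u = b - c and v = 2 c, the binary form u^2 + u v + v^2 becomes b^2 + 3
    c^2.\<close>
  also have "\<dots> = ternary (k * (s * y) - k * (s * z)) (2 * (k * (s * z))) (k * (x * u))"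
    by (simp add: ternary_def power2_eq_square algebra_simps)
  also have "(w * u)\<^sup>2 = (int (nat \<bar>w * u\<bar>))\<^sup>2" by simp
  finally have "int N * (int (nat \<bar>w * u\<bar>))\<^sup>2 = ternary (k * (s * y) - k * (s * z)) (2 * (k * (s * z))) (k * (x * u))" .
  moreover have "nat \<bar>w * u\<bar> > 0" using eq1(2) eq2(2) by simp
  ultimately obtain x y z where "int N = ternary x y z" using ternary_descent by blast
  then show ?thesis using ternary_to_diagonal by metis
qed

section \<open>Polygonal numbers\<close>

lemma odd_square_mod_8: "odd (x::int) \<Longrightarrow> x\<^sup>2 mod 8 = 1"
proof -
  assume "odd x"
  then obtain k where "x = 2 * k + 1" by (elim oddE)
  then have "x\<^sup>2 = 4 * (k * (k + 1)) + 1" by (simp add: power2_eq_square algebra_simps)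
  moreover have "even (k * (k + 1))" by simp
  then obtain j where "k * (k + 1) = 2 * j" by (elim evenE)
  ultimately have "x\<^sup>2 = 8 * j + 1" by simp
  then show ?thesis by simp
qed

lemma square_mod_3:
  fixes x :: int
  shows "x mod 3 = 0 \<and> x\<^sup>2 mod 3 = 0 \<or> x mod 3 \<noteq> 0 \<and> x\<^sup>2 mod 3 = 1"
proof -
  have "x mod 3 = 0 \<or> x mod 3 = 1 \<or> x mod 3 = 2" by presburger
  moreover have "x\<^sup>2 mod 3 = (x mod 3)\<^sup>2 mod 3" by (simp add: power_mod)
  ultimately show ?thesis by auto
qed

lemma square_mod_5:
  fixes x :: int
  shows "x mod 5 = 0 \<and> x\<^sup>2 mod 5 = 0 \<or> (x mod 5 = 1 \<or> x mod 5 = 4) \<and> x\<^sup>2 mod 5 = 1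
    \<or> (x mod 5 = 2 \<or> x mod 5 = 3) \<and> x\<^sup>2 mod 5 = 4"
proof -
  have "x mod 5 = 0 \<or> x mod 5 = 1 \<or> x mod 5 = 2 \<or> x mod 5 = 3 \<or> x mod 5 = 4" by presburger
  moreover have "x\<^sup>2 mod 5 = (x mod 5)\<^sup>2 mod 5" by (simp add: power_mod)
  ultimately show ?thesis by auto
qed

lemma square_mod_9_eq_4:
  fixes x :: int
  assumes "x\<^sup>2 mod 9 = 4"
  shows "x mod 9 = 2 \<or> x mod 9 = 7"
proof -
  have "0 \<le> x mod 9" "x mod 9 < 9" by simp_all
  then have "x mod 9 \<in> {0..<9}" by simp
  also have "{0..<9::int} = {0,1,2,3,4,5,6,7,8}" by auto
  finally have "x mod 9 \<in> {0,1,2,3,4,5,6,7,8}" .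
  moreover have "x\<^sup>2 mod 9 = (x mod 9)\<^sup>2 mod 9" by (simp add: power_mod)
  ultimately show ?thesis using assms by auto
qed

lemma diagonal_form_mod:
  fixes x y z k N :: int
  assumes "N = x\<^sup>2 + y\<^sup>2 + 3 * z\<^sup>2"
  shows "N mod k = (x\<^sup>2 mod k + y\<^sup>2 mod k + 3 * (z\<^sup>2 mod k)) mod k"
  unfolding assms by (metis mod_add_eq mod_mult_right_eq)

text \<open>Only squares enter the diagonal equations, so the sign of x may be changed to reach the
  residue class - r.\<close>

lemma plus_minus_residue:
  fixes x :: int
  assumes "m dvd x + r \<or> m dvd x - r"
  obtains k where "x\<^sup>2 = (m * k - r)\<^sup>2"
  using assms
proof
  assume "m dvd x + r"
  then obtain k where "x + r = m * k" ..
  then have "x = m * k - r" by simp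
  with that show ?thesis by blast
next
  assume "m dvd x - r"
  then obtain k where "x - r = m * k" ..
  then have "x = - (m * (- k) - r)" by simp
  with that show ?thesis by (metis power2_minus)
qed

text \<open>Multiplication of x + z sqrt(-3) by a primitive sixth root of unity, up to signs. The
  numbers (x - z) / 2 and (x + z) / 2 differ by the odd z, so exactly one is odd, and this decides
  the direction of the rotation.\<close>

lemma rotate_odd:
  fixes x z :: int
  assumes "odd x" "odd z"
  obtains x' z' where "odd x'" "odd z'" "x'\<^sup>2 + 3 * z'\<^sup>2 = x\<^sup>2 + 3 * z\<^sup>2" "2 * z' = x - z \<or> 2 * z' = x + z"
proof -
  note result = that
  have *: thesis if "odd w" "2 * w = x - t" "t = z \<or> t = - z" for w t
  proof (rule result[of "w + 2 * t" w])
    have x: "x = 2 * w + t" using that by simp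
    have "z\<^sup>2 = t\<^sup>2" using that by auto
    then show "(w + 2 * t)\<^sup>2 + 3 * w\<^sup>2 = x\<^sup>2 + 3 * z\<^sup>2"
      unfolding x by (simp add: power2_eq_square algebra_simps)
  qed (use that in auto)
  obtain a where a: "x - z = 2 * a" using assms by (metis evenE odd_even_add uminus_add_conv_diff add.commute even_minus)
  show thesis
  proof (cases "odd a")
    case True
    then show ?thesis using *[of a z] a by simp
  next
    case False
    have "x + z = 2 * (a + z)" using a by simp
    then show ?thesis using *[of "a + z" "- z"] False assms by simp
  qed
qed

text \<open>Modulo 4, either all three variables are odd or only one of x, y is. In the latter case
  4 (v^2 + 3 w^2) = (v + 3 w)^2 + 3 (v - w)^2 is applied to the halved even variables.
  \<open>N mod 8 = 5\<close> forces v + w to be odd, which makes both new variables odd.\<close>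

lemma all_odd_representation:
  fixes N :: int
  assumes N: "N = x\<^sup>2 + y\<^sup>2 + 3 * z\<^sup>2" and N8: "N mod 8 = 5"
  obtains x y z where "odd x" "odd y" "odd z" "N = x\<^sup>2 + y\<^sup>2 + 3 * z\<^sup>2"
proof -
  note result = that
  have sq: "even t \<Longrightarrow> t\<^sup>2 mod 4 = 0" "odd t \<Longrightarrow> t\<^sup>2 mod 4 = 1" for t :: int
    using odd_square_mod_8[of t] by (auto simp: power2_eq_square elim!: evenE) presburger
  have N4: "N mod 4 = 1" using N8 by presburger
  have **: thesis if eq: "N = u\<^sup>2 + v\<^sup>2 + 3 * w\<^sup>2" and "odd u" "even v" "even w" for u v w
  proof -
    obtain v' w' where v: "v = 2 * v'" and w: "w = 2 * w'" using \<open>even v\<close> \<open>even w\<close> by (auto elim!: evenE)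
    have "N = u\<^sup>2 + 4 * (v'\<^sup>2 + 3 * w'\<^sup>2)" using eq by (simp add: v w)
    moreover have "odd s" if "N = r + 4 * s" "r mod 8 = 1" for r s using that N8 by presburger
    ultimately have "odd (v'\<^sup>2 + 3 * w'\<^sup>2)" using odd_square_mod_8[OF \<open>odd u\<close>] by blast
    then have "odd (v' + w')" by simp
    moreover have "N = u\<^sup>2 + (v' + 3 * w')\<^sup>2 + 3 * (v' - w')\<^sup>2"
      unfolding eq v w by (simp add: power2_eq_square algebra_simps)
    ultimately show thesis using \<open>odd u\<close> result[of u "v' + 3 * w'" "v' - w'"] by simp
  qed
  have cases4: "a = 1 \<and> b = 1 \<and> c = 1 \<or> a = 1 \<and> b = 0 \<and> c = 0 \<or> a = 0 \<and> b = 1 \<and> c = 0"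
    if "a = 0 \<or> a = 1" "b = 0 \<or> b = 1" "c = 0 \<or> c = 1" "(a + b + 3 * c) mod 4 = 1" for a b c :: int
    using that by (elim disjE; hypsubst; simp)
  have sq4: "t\<^sup>2 mod 4 = 0 \<or> t\<^sup>2 mod 4 = 1" for t :: int
    using sq[of t] by blast
  have cases: "x\<^sup>2 mod 4 = 1 \<and> y\<^sup>2 mod 4 = 1 \<and> z\<^sup>2 mod 4 = 1 \<or> x\<^sup>2 mod 4 = 1 \<and> y\<^sup>2 mod 4 = 0 \<and> z\<^sup>2 mod 4 = 0
      \<or> x\<^sup>2 mod 4 = 0 \<and> y\<^sup>2 mod 4 = 1 \<and> z\<^sup>2 mod 4 = 0"
    by (rule cases4[OF sq4 sq4 sq4]) (metis diagonal_form_mod[OF N] N4)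
  have o: "odd t" if "t\<^sup>2 mod 4 = 1" for t :: int using sq(1)[of t] that by fastforce
  have e: "even t" if "t\<^sup>2 mod 4 = 0" for t :: int using sq(2)[of t] that by fastforce
  from cases show thesis
  proof (elim disjE conjE)
    assume "x\<^sup>2 mod 4 = 1" "y\<^sup>2 mod 4 = 1" "z\<^sup>2 mod 4 = 1"
    then show ?thesis by (intro that[OF _ _ _ N] o)
  next
    assume "x\<^sup>2 mod 4 = 1" "y\<^sup>2 mod 4 = 0" "z\<^sup>2 mod 4 = 0"
    then show ?thesis by (intro **[OF N] o e)
  next
    assume "x\<^sup>2 mod 4 = 0" "y\<^sup>2 mod 4 = 1" "z\<^sup>2 mod 4 = 0"
    moreover have "N = y\<^sup>2 + x\<^sup>2 + 3 * z\<^sup>2" using N by simp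
    ultimately show ?thesis by (intro **[of y x z] o e)
  qed
qed

section \<open>From the diagonal form to polygonal numbers\<close>

lemma double_polygonal: "2 * polygonal m x = (int m - 2) * (x * (x - 1)) + 2 * x"
proof -
  have "2 * (x * (x - 1) div 2) = x * (x - 1)" by simp
  moreover have "2 * polygonal m x = (int m - 2) * (2 * (x * (x - 1) div 2)) + 2 * x"
    by (simp add: polygonal_def algebra_simps)
  ultimately show ?thesis by metis
qed

text \<open>The squares behind it are 8 p_3(X) + 1 = (2 X + 1)^2, 24 p_5(Y) + 1 = (6 Y - 1)^2 and 72
  p_11(Z) + 49 = (18 Z - 7)^2, whence 61 = 9 + 3 + 49. The variables y, z, x are steered in this
  order to 3 (2 X + 1) and, up to sign, to 6 Y - 1 and 18 Z - 7.\<close>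

lemma representation_3_5_11:
  fixes n :: int
  assumes rep: "72 * n + 61 = x\<^sup>2 + y\<^sup>2 + 3 * z\<^sup>2"
  shows "\<exists>x y z. n = polygonal 3 x + polygonal 5 y + polygonal 11 z"
proof -
  define N where "N = 72 * n + 61"
  have N8: "N mod 8 = 5" and N9: "N mod 9 = 7" and N3: "N mod 3 = 1"
    unfolding N_def by presburger+
  obtain x y z where odd: "odd x" "odd y" "odd z" and N: "N = x\<^sup>2 + y\<^sup>2 + 3 * z\<^sup>2"
    using all_odd_representation[OF rep[folded N_def] N8] by blast
  obtain x y where odd: "odd x" "odd y" and N: "N = x\<^sup>2 + y\<^sup>2 + 3 * z\<^sup>2" and y: "y mod 3 = 0" and x: "x mod 3 \<noteq> 0"
  proof -
    have cases3: "a = 0 \<and> b = 1 \<or> a = 1 \<and> b = 0"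
      if "a = 0 \<or> a = 1" "b = 0 \<or> b = 1" "(a + b + 3 * c) mod 3 = 1" for a b c :: int
      using that by (elim disjE; hypsubst; simp)
    have sq3: "t\<^sup>2 mod 3 = 0 \<or> t\<^sup>2 mod 3 = 1" for t :: int
      using square_mod_3[of t] by blast
    have "x\<^sup>2 mod 3 = 0 \<and> y\<^sup>2 mod 3 = 1 \<or> x\<^sup>2 mod 3 = 1 \<and> y\<^sup>2 mod 3 = 0"
      by (rule cases3[OF sq3 sq3, where c = "z\<^sup>2 mod 3"]) (metis diagonal_form_mod[OF N] N3)
    then show thesis
    proof (elim disjE conjE)
      assume "x\<^sup>2 mod 3 = 0" "y\<^sup>2 mod 3 = 1"
      then have "x mod 3 = 0" "y mod 3 \<noteq> 0" using square_mod_3[of x] square_mod_3[of y] by linarith+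
      moreover have "N = y\<^sup>2 + x\<^sup>2 + 3 * z\<^sup>2" using N by simp
      ultimately show thesis by (intro that[OF odd(2,1)])
    next
      assume "x\<^sup>2 mod 3 = 1" "y\<^sup>2 mod 3 = 0"
      then have "y mod 3 = 0" "x mod 3 \<noteq> 0" using square_mod_3[of x] square_mod_3[of y] by linarith+
      then show thesis by (intro that[OF odd(1,2) N])
    qed
  qed
  \<comment> \<open>If 3 divides z, then 2 z' = x - z or x + z makes z' prime to 3 because x is; y
    is untouched.\<close>
  obtain x z where odd: "odd x" "odd y" "odd z" and N: "N = x\<^sup>2 + y\<^sup>2 + 3 * z\<^sup>2" and z: "z mod 3 \<noteq> 0"
  proof (cases "z mod 3 = 0")
    case True
    obtain x' z' where *: "odd x'" "odd z'" "x'\<^sup>2 + 3 * z'\<^sup>2 = x\<^sup>2 + 3 * z\<^sup>2" "2 * z' = x - z \<or> 2 * z' = x + z"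
      using rotate_odd[OF \<open>odd x\<close> \<open>odd z\<close>] .
    have "z' mod 3 \<noteq> 0" using *(4) x True by (elim disjE; presburger)
    then show ?thesis using that[of x' z'] * N odd by simp
  next
    case False
    then show ?thesis using that[of x z] N odd \<open>odd z\<close> by simp
  qed
  have "\<exists>X. y = 3 * (2 * X + 1)" using \<open>odd y\<close> y by presburger
  then obtain X where X: "y = 3 * (2 * X + 1)" ..
  have "6 dvd z + 1 \<or> 6 dvd z - 1" using \<open>odd z\<close> z by presburger
  then obtain Y where Y: "z\<^sup>2 = (6 * Y - 1)\<^sup>2" by (rule plus_minus_residue)
  have y9: "y\<^sup>2 mod 9 = 0" unfolding X power_mult_distrib by simp
  have z9: "3 * z\<^sup>2 mod 9 = 3"
  proof -
    have "z\<^sup>2 mod 3 = 1" using square_mod_3[of z] z by simp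
    then show ?thesis using mult_mod_right[of 3 "z\<^sup>2" 3] by simp
  qed
  \<comment> \<open>The condition modulo 9 comes for free: 7 - 0 - 3 = 4, and the square roots of 4
    modulo 9 are 7 and -7.\<close>
  have "x\<^sup>2 = (N - y\<^sup>2) - 3 * z\<^sup>2" using N by simp
  then have "x\<^sup>2 mod 9 = ((N mod 9 - y\<^sup>2 mod 9) mod 9 - 3 * z\<^sup>2 mod 9) mod 9" by (metis mod_diff_eq)
  then have "x\<^sup>2 mod 9 = 4" unfolding y9 z9 N9 by simp
  then have "x mod 9 = 2 \<or> x mod 9 = 7" by (rule square_mod_9_eq_4)
  then have "18 dvd x + 7 \<or> 18 dvd x - 7" using \<open>odd x\<close> by presburger
  then obtain Z where Z: "x\<^sup>2 = (18 * Z - 7)\<^sup>2" by (rule plus_minus_residue)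
  have "72 * n + 61 = (18 * Z - 7)\<^sup>2 + (3 * (2 * X + 1))\<^sup>2 + 3 * (6 * Y - 1)\<^sup>2"
    using N N_def X Y Z by simp
  then have "2 * n = 2 * polygonal 3 X + 2 * polygonal 5 Y + 2 * polygonal 11 Z"
    unfolding double_polygonal by (simp add: power2_eq_square algebra_simps)
  then show ?thesis by (intro exI[of _ X] exI[of _ Y] exI[of _ Z]) simp
qed

text \<open>Here 40 p_7(Z) + 9 = (10 Z - 3)^2, whence 77 = 45 + 5 + 27. So z has to be 3 or -3
  modulo 10, and x^2 + y^2 has to be 5 (a^2 + b^2) with a, b odd and exactly one of them divisible
  by 3.\<close>

lemma representation_3_5_7:
  fixes n :: int
  assumes rep: "120 * n + 77 = x\<^sup>2 + y\<^sup>2 + 3 * z\<^sup>2"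
  shows "\<exists>x y z. n = 3 * polygonal 3 x + polygonal 5 y + polygonal 7 z"
proof -
  define N where "N = 120 * n + 77"
  have "N = 5 + (15 * n + 9) * 8" "N = 2 + (40 * n + 25) * 3" "N = 2 + (24 * n + 15) * 5" by (simp_all add: N_def)
  then have N8: "N mod 8 = 5" and N3: "N mod 3 = 2" and N5: "N mod 5 = 2"
    using mod_mult_self1[of 5 "15 * n + 9" 8] mod_mult_self1[of 2 "40 * n + 25" 3] mod_mult_self1[of 2 "24 * n + 15" 5]
    by simp_all
  obtain x y z where odd: "odd x" "odd y" "odd z" and N: "N = x\<^sup>2 + y\<^sup>2 + 3 * z\<^sup>2"
    using all_odd_representation[OF rep[folded N_def] N8] by blast
  obtain x y z where odd: "odd x" "odd y" "odd z" and N: "N = x\<^sup>2 + y\<^sup>2 + 3 * z\<^sup>2" and z: "z mod 5 = 2 \<or> z mod 5 = 3"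
  proof -
    note result = that
    \<comment> \<open>In the bad cases modulo 5, some pair (u, w) has one entry 0 and the other 1 or
      -1. Since 3 inverts 2 modulo 5, the rotated entry is 3 (u - w) or 3 (u + w), that is, 3 or
      -3.\<close>
    have *: thesis if "odd u" "odd v" "odd w" "N = u\<^sup>2 + v\<^sup>2 + 3 * w\<^sup>2"
      "u mod 5 = 0 \<and> (w mod 5 = 1 \<or> w mod 5 = 4) \<or> (u mod 5 = 1 \<or> u mod 5 = 4) \<and> w mod 5 = 0" for u v w
    proof -
      obtain u' w' where *: "odd u'" "odd w'" "u'\<^sup>2 + 3 * w'\<^sup>2 = u\<^sup>2 + 3 * w\<^sup>2" "2 * w' = u - w \<or> 2 * w' = u + w"
        using rotate_odd[OF \<open>odd u\<close> \<open>odd w\<close>] .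
      have "w' mod 5 = 2 \<or> w' mod 5 = 3" 
      proof -
        have "3 * (u - w) = w' + 5 * w' \<or> 3 * (u + w) = w' + 5 * w'" using *(4) by auto
        then have "w' mod 5 = 3 * (u - w) mod 5 \<or> w' mod 5 = 3 * (u + w) mod 5" by (metis mod_mult_self2)
        moreover have "3 * (u - w) mod 5 = 3 * (u mod 5 - w mod 5) mod 5" "3 * (u + w) mod 5 = 3 * (u mod 5 + w mod 5) mod 5"
          by (metis mod_diff_eq mod_mult_right_eq, metis mod_add_eq mod_mult_right_eq)
        ultimately have "w' mod 5 = 3 * (u mod 5 - w mod 5) mod 5 \<or> w' mod 5 = 3 * (u mod 5 + w mod 5) mod 5" by metis
        then show ?thesis using that(5) by (elim disjE conjE; simp only:; simp)
      qed
      then show thesis using result[of u' v w'] * that by simp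
    qed
    have cases5: "c = 4 \<or> a = 0 \<and> c = 1 \<or> b = 0 \<and> c = 1 \<or> a = 1 \<and> c = 0"
      if "a = 0 \<or> a = 1 \<or> a = 4" "b = 0 \<or> b = 1 \<or> b = 4" "c = 0 \<or> c = 1 \<or> c = 4" "(a + b + 3 * c) mod 5 = 2"
      for a b c :: int
      using that by (elim disjE; hypsubst; simp)
    have sq5: "t\<^sup>2 mod 5 = 0 \<or> t\<^sup>2 mod 5 = 1 \<or> t\<^sup>2 mod 5 = 4" for t :: int
      using square_mod_5[of t] by blast
    have "z\<^sup>2 mod 5 = 4 \<or> x\<^sup>2 mod 5 = 0 \<and> z\<^sup>2 mod 5 = 1 \<or> y\<^sup>2 mod 5 = 0 \<and> z\<^sup>2 mod 5 = 1
        \<or> x\<^sup>2 mod 5 = 1 \<and> z\<^sup>2 mod 5 = 0"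
      by (rule cases5[OF sq5 sq5 sq5]) (metis diagonal_form_mod[OF N] N5)
    moreover have "t\<^sup>2 mod 5 = 0 \<Longrightarrow> t mod 5 = 0" "t\<^sup>2 mod 5 = 1 \<Longrightarrow> t mod 5 = 1 \<or> t mod 5 = 4"
        "t\<^sup>2 mod 5 = 4 \<Longrightarrow> t mod 5 = 2 \<or> t mod 5 = 3" for t :: int
      using square_mod_5[of t] by (elim disjE conjE; simp only:; simp)+
    ultimately have "z mod 5 = 2 \<or> z mod 5 = 3 \<or> x mod 5 = 0 \<and> (z mod 5 = 1 \<or> z mod 5 = 4)
        \<or> y mod 5 = 0 \<and> (z mod 5 = 1 \<or> z mod 5 = 4) \<or> (x mod 5 = 1 \<or> x mod 5 = 4) \<and> z mod 5 = 0"
      by meson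
    then consider "z mod 5 = 2 \<or> z mod 5 = 3"
      | "x mod 5 = 0 \<and> (z mod 5 = 1 \<or> z mod 5 = 4) \<or> (x mod 5 = 1 \<or> x mod 5 = 4) \<and> z mod 5 = 0"
      | "y mod 5 = 0 \<and> (z mod 5 = 1 \<or> z mod 5 = 4)" by blast
    then show thesis
    proof cases
      case 1
      then show ?thesis by (rule result[OF odd N])
    next
      case 2
      then show ?thesis by (rule *[OF odd N])
    next
      case 3
      have "N = y\<^sup>2 + x\<^sup>2 + 3 * z\<^sup>2" using N by simp
      then show ?thesis by (rule *[OF odd(2,1,3) _ disjI1[OF 3]])
    qed
  qed
  have cases3: "a = 1 \<and> b = 1" if "a = 0 \<or> a = 1" "b = 0 \<or> b = 1" "(a + b + 3 * c) mod 3 = 2" for a b c :: int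
    using that by (elim disjE; hypsubst; simp)
  have sq3: "t\<^sup>2 mod 3 = 0 \<or> t\<^sup>2 mod 3 = 1" for t :: int
    using square_mod_3[of t] by blast
  have "x\<^sup>2 mod 3 = 1 \<and> y\<^sup>2 mod 3 = 1"
    by (rule cases3[OF sq3 sq3, where c = "z\<^sup>2 mod 3"]) (metis diagonal_form_mod[OF N] N3)
  then have x: "x mod 3 \<noteq> 0" and y: "y mod 3 \<noteq> 0" by auto
  have z2: "z\<^sup>2 mod 5 = 4" using square_mod_5[of z] z by auto
  have "10 dvd z + 3 \<or> 10 dvd z - 3" using z \<open>odd z\<close> by presburger
  then obtain Z where Z: "z\<^sup>2 = (10 * Z - 3)\<^sup>2" by (rule plus_minus_residue)
  \<comment> \<open>x^2 + y^2 = 2 - 3 * 4 = 0 (mod 5), so 5 divides (x + 2 y) (x - 2 y). The sign of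
    t selects which of the Gaussian primes 2 + i and 2 - i is divided out.\<close>
  obtain t where t: "t = y \<or> t = - y" and t5: "(x + 2 * t) mod 5 = 0"
  proof -
    have "(x + 2 * y) mod 5 = 0 \<or> (x + 2 * (- y)) mod 5 = 0"
    proof -
      have "a mod 5 = 0" if "a + 3 * c = N" "c mod 5 = 4" for a c using that N5 by presburger
      then have "(x\<^sup>2 + y\<^sup>2) mod 5 = 0" using N z2 by blast
      then have "5 dvd x\<^sup>2 + y\<^sup>2" by presburger
      moreover have "(x + 2 * y) * (x + 2 * (- y)) = (x\<^sup>2 + y\<^sup>2) - 5 * y\<^sup>2"
        by (simp add: power2_eq_square algebra_simps)
      ultimately have "5 dvd (x + 2 * y) * (x + 2 * (- y))" by (metis dvd_diff dvd_triv_left)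
      then show ?thesis using prime_dvd_mult_iff[of 5 "x + 2 * y"] by (simp add: dvd_eq_mod_eq_0)
    qed
    then show thesis
    proof
      assume "(x + 2 * y) mod 5 = 0"
      then show thesis by (rule that[OF disjI1[OF refl]])
    next
      assume "(x + 2 * (- y)) mod 5 = 0"
      then show thesis by (rule that[OF disjI2[OF refl]])
    qed
  qed
  have "5 dvd x + 2 * t" using t5 by (simp add: dvd_eq_mod_eq_0)
  then obtain a where a: "x + 2 * t = 5 * a" ..
  define b where "b = 2 * a - t"
  have xt: "x = a + 2 * b" "t = 2 * a - b" using a by (simp_all add: b_def)
  have "y\<^sup>2 = t\<^sup>2" using t by auto
  then have Nab: "N = 5 * a\<^sup>2 + 5 * b\<^sup>2 + 3 * z\<^sup>2"
    unfolding N by (simp add: xt power2_eq_square algebra_simps)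
  have "odd t" using t \<open>odd y\<close> by (elim disjE) simp_all
  moreover have "t mod 3 \<noteq> 0" using t y by (elim disjE) (simp_all add: mod_eq_0_iff_dvd)
  \<comment> \<open>Modulo 3, x = a - b and t = - (a + b). Both are nonzero, so exactly one of a, b
    vanishes.\<close>
  ultimately have ab: "odd a" "odd b" "a mod 3 = 0 \<and> b mod 3 \<noteq> 0 \<or> a mod 3 \<noteq> 0 \<and> b mod 3 = 0"
    using \<open>odd x\<close> x xt by presburger+
  obtain a b where ab: "odd a" "odd b" "a mod 3 = 0" "b mod 3 \<noteq> 0" and N: "N = 5 * a\<^sup>2 + 5 * b\<^sup>2 + 3 * z\<^sup>2"
  proof -
    have "N = 5 * b\<^sup>2 + 5 * a\<^sup>2 + 3 * z\<^sup>2" using Nab by simp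
    with ab(3) show thesis
    proof (elim disjE conjE)
      assume "a mod 3 = 0" "b mod 3 \<noteq> 0"
      then show thesis by (rule that[OF ab(1,2) _ _ Nab])
    next
      assume "a mod 3 \<noteq> 0" "b mod 3 = 0" "N = 5 * b\<^sup>2 + 5 * a\<^sup>2 + 3 * z\<^sup>2"
      then show thesis by (intro that[OF ab(2,1)])
    qed
  qed
  have "\<exists>X. a = 3 * (2 * X + 1)" using ab by presburger
  then obtain X where X: "a = 3 * (2 * X + 1)" ..
  have "6 dvd b + 1 \<or> 6 dvd b - 1" using ab by presburger
  then obtain Y where Y: "b\<^sup>2 = (6 * Y - 1)\<^sup>2" by (rule plus_minus_residue)
  have "120 * n + 77 = 5 * (3 * (2 * X + 1))\<^sup>2 + 5 * (6 * Y - 1)\<^sup>2 + 3 * (10 * Z - 3)\<^sup>2"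
    using N N_def X Y Z by simp
  then have "2 * n = 3 * (2 * polygonal 3 X) + 2 * polygonal 5 Y + 2 * polygonal 7 Z"
    unfolding double_polygonal by (simp add: power2_eq_square algebra_simps)
  then show ?thesis by (intro exI[of _ X] exI[of _ Y] exI[of _ Z]) simp
qed

theorem theorem1p2:
  shows "(\<forall>n::nat. \<exists>x y z::int. int n = polygonal 3 x + polygonal 5 y + polygonal 11 z) \<and>
         (\<forall>n::nat. \<exists>x y z::int. int n = 3 * polygonal 3 x + polygonal 5 y + polygonal 7 z)"
proof (intro conjI allI)
  fix n :: nat
  have "(72 * n + 61) mod 4 = 1" "\<not> 3 dvd 72 * n + 61" by presburger+
  then obtain x y z :: int where "int (72 * n + 61) = x\<^sup>2 + y\<^sup>2 + 3 * z\<^sup>2"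
    using diagonal_representation by blast
  then show "\<exists>x y z::int. int n = polygonal 3 x + polygonal 5 y + polygonal 11 z"
    by (intro representation_3_5_11) simp
next
  fix n :: nat
  have "(120 * n + 77) mod 4 = 1" "\<not> 3 dvd 120 * n + 77" by presburger+
  then obtain x y z :: int where "int (120 * n + 77) = x\<^sup>2 + y\<^sup>2 + 3 * z\<^sup>2"
    using diagonal_representation by blast
  then show "\<exists>x y z::int. int n = 3 * polygonal 3 x + polygonal 5 y + polygonal 7 z"
    by (intro representation_3_5_7) simp
qed

end
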